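(* Let $\mathbb{G}$ be a compact quantum group with dense Hopf $*$-algebra $\mathcal{A}=\mathrm{Pol}(\mathbb{G})$ and Haar state $h$. Denote by $\widetilde S$ the twisted antipode $\widetilde S(a)=f_1\star S(a)=f_{-1}(a_{(1)})S(a_{(2)})$ and by $\widetilde{\mathrm{ad}}$ the twisted adjoint action $\widetilde{\mathrm{ad}}(a)=a_{(1)}\widetilde S(a_{(3)})\otimes a_{(2)}$, $a\in\mathcal{A}$. (a) The map $\widetilde{\mathrm{ad}}_h:\mathcal{A}\to\mathcal{A}$ defined by $\widetilde{\mathrm{ad}}_h(a)=(h\otimes\mathrm{id})\circ\widetilde{\mathrm{ad}}(a)=h\big(a_{(1)}\widetilde S(a_{(3)})\big)a_{(2)}$ satisfies $$\widetilde{\mathrm{ad}}_h(a^*a)=(h\otimes\mathrm{id})\Big(\big(\widetilde{\mathrm{ad}}(a)\big)^*\,\widetilde{\mathrm{ad}}(a)\Big)$$ for all $a\in\mathcal{A}$, and therefore preserves positivity. (b) If $\mathbb{G}$ is of Kac type, then $\widetilde{\mathrm{ad}}_h\circ\widetilde{\mathrm{ad}}_h=\widetilde{\mathrm{ad}}_h$.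
   Context: $\mathcal{A}$ is the dense Hopf $*$-algebra spanned by coefficients of finite-dimensional unitary corepresentations of the compact quantum group $\mathbb{G}=(\mathsf{A},\Delta)$, with counit $\varepsilon$, antipode $S$, and Haar state $h$ (faithful on $\mathcal{A}$, two-sided invariant). Sweedler notation: $\Delta(a)=a_{(1)}\otimes a_{(2)}$, $(\Delta\otimes\mathrm{id})\Delta(a)=a_{(1)}\otimes a_{(2)}\otimes a_{(3)}$ (sums suppressed). For $\lambda,\mu\in\mathcal{A}'$, $a\in\mathcal{A}$: $\lambda\star\mu=(\lambda\otimes\mu)\circ\Delta$, $\lambda\star a=(\mathrm{id}\otimes\lambda)\Delta(a)$, $a\star\lambda=(\lambda\otimes\mathrm{id})\Delta(a)$. Woronowicz characters: $(f_z)_{z\in\mathbb{C}}$ is the unique family of multiplicative linear functionals on $\mathcal{A}$ with $f_z(1)=1$, $z\mapsto f_z(a)$ entire, $f_0=\varepsilon$, $f_{z_1}\star f_{z_2}=f_{z_1+z_2}$, $f_z(S(a))=f_{-z}(a)$, $f_{\bar z}(a^* )=\overline{f_{-z}(a)}$, $S^2(a)=f_{-1}\star a\star f_1$, $h(ab)=h(b(f_1\star a\star f_1))$. $\mathbb{G}$ is of Kac type if $S^2=\mathrm{id}$ on $\mathcal{A}$ (equivalently $h$ is a trace; equivalently $f_z=\varepsilon$ for all $z$). The involution on $\mathcal{A}\odot\mathcal{A}$ is $(a\otimes b)^*=a^*\otimes b^*$. "Preserves positivity" means that each $\widetilde{\mathrm{ad}}_h(a^*a)$ is a finite sum of elements $b^*b$,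 $b\in\mathcal{A}$; in particular $\omega\circ\widetilde{\mathrm{ad}}_h$ is a positive functional on $\mathcal{A}$ whenever $\omega$ is. *)

theory Defs
  imports "HOL-Analysis.Analysis" "HOL-Library.Multiset"
begin

section \<open>Unital complex *-algebras\<close>

class complex_vs = ab_group_add +
  fixes scaleC :: "complex \<Rightarrow> 'a \<Rightarrow> 'a"  (infixr "*\<^sub>C" 75)
  assumes scaleC_add_right: "c *\<^sub>C (x + y) = c *\<^sub>C x + c *\<^sub>C y"
    and scaleC_add_left: "(c + d) *\<^sub>C x = c *\<^sub>C x + d *\<^sub>C x"
    and scaleC_scaleC: "c *\<^sub>C d *\<^sub>C x = (c * d) *\<^sub>C x"
    and scaleC_one: "1 *\<^sub>C x = x"

global_interpretation complex_vs: vector_space "scaleC :: complex \<Rightarrow> 'a \<Rightarrow> 'a :: complex_vs"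
  by unfold_locales (rule scaleC_add_right scaleC_add_left scaleC_scaleC scaleC_one)+

abbreviation clinear :: "('a::complex_vs \<Rightarrow> 'b::complex_vs) \<Rightarrow> bool" where
  "clinear \<equiv> Vector_Spaces.linear scaleC scaleC"

class star_algebra = complex_vs + ring + monoid_mult +
  fixes star :: "'a \<Rightarrow> 'a"  ("_\<^sup>\<star>" [1000] 999)
  assumes mult_scaleC_left: "(c *\<^sub>C x) * y = c *\<^sub>C (x * y)"
    and mult_scaleC_right: "x * (c *\<^sub>C y) = c *\<^sub>C (x * y)"
    and star_add: "(x + y)\<^sup>\<star> = x\<^sup>\<star> + y\<^sup>\<star>"
    and star_scaleC: "(c *\<^sub>C x)\<^sup>\<star> = cnj c *\<^sub>C x\<^sup>\<star>"
    and star_mult: "(x * y)\<^sup>\<star> = y\<^sup>\<star> * x\<^sup>\<star>"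
    and star_star: "(x\<^sup>\<star>)\<^sup>\<star> = x"

instantiation complex :: star_algebra
begin
definition scaleC_complex_def: "c *\<^sub>C (x::complex) = c * x"
definition star_complex_def: "(x::complex)\<^sup>\<star> = cnj x"
instance
  by standard (simp_all add: scaleC_complex_def star_complex_def algebra_simps)
end

definition alg_hom :: "('a::star_algebra \<Rightarrow> 'b::star_algebra) \<Rightarrow> bool" where
  "alg_hom f \<longleftrightarrow> clinear f \<and> f 1 = 1 \<and> (\<forall>x y. f (x * y) = f x * f y)"

definition star_hom :: "('a::star_algebra \<Rightarrow> 'b::star_algebra) \<Rightarrow> bool" where
  "star_hom f \<longleftrightarrow> alg_hom f \<and> (\<forall>x. f (x\<^sup>\<star>) = (f x)\<^sup>\<star>)"

definition positive_functional :: "('a::star_algebra \<Rightarrow> complex) \<Rightarrow> bool" where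
  "positive_functional \<omega> \<longleftrightarrow> clinear \<omega> \<and> (\<forall>a. \<omega> (a\<^sup>\<star> * a) \<in> \<real>\<^sub>\<ge>\<^sub>0)"

definition state :: "('a::star_algebra \<Rightarrow> complex) \<Rightarrow> bool" where
  "state \<omega> \<longleftrightarrow> positive_functional \<omega> \<and> \<omega> 1 = 1"

definition preserves_positivity :: "('a::star_algebra \<Rightarrow> 'a) \<Rightarrow> bool" where
  "preserves_positivity T \<longleftrightarrow>
     (\<forall>a. \<exists>(n::nat) b. T (a\<^sup>\<star> * a) = (\<Sum>i<n. (b i)\<^sup>\<star> * b i))"

section \<open>The algebraic tensor product over the complex numbers\<close>

text \<open>Elements are formal sums of pairs, that is multisets, modulo bilinearity. The scalar action
  is not part of the formal sums: it is induced from either factor.\<close>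

inductive tensor_eq :: "('a::complex_vs \<times> 'b::complex_vs) multiset \<Rightarrow> ('a \<times> 'b) multiset \<Rightarrow> bool" where
  refl: "tensor_eq M M"
| sym: "tensor_eq M N \<Longrightarrow> tensor_eq N M"
| trans: "tensor_eq M N \<Longrightarrow> tensor_eq N P \<Longrightarrow> tensor_eq M P"
| plus: "tensor_eq M N \<Longrightarrow> tensor_eq (M + P) (N + P)"
| zero: "tensor_eq {#(0, b)#} {#}"
| add_left: "tensor_eq {#(a + a', b)#} {#(a, b), (a', b)#}"
| add_right: "tensor_eq {#(a, b + b')#} {#(a, b), (a, b')#}"
| scale: "tensor_eq {#(c *\<^sub>C a, b)#} {#(a, c *\<^sub>C b)#}"

quotient_type (overloaded) ('a, 'b) tensor (infixr "\<otimes>" 70) =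
  "('a::complex_vs \<times> 'b::complex_vs) multiset" / tensor_eq
  by (rule equivpI) (auto simp: reflp_def symp_def transp_def
      intro: tensor_eq.refl tensor_eq.sym tensor_eq.trans)

lift_definition pure_tensor :: "'a::complex_vs \<Rightarrow> 'b::complex_vs \<Rightarrow> 'a \<otimes> 'b"  (infixr "\<otimes>" 72)
  is "\<lambda>a b. {#(a, b)#}" .

lemma tensor_eq_plus2:
  assumes "tensor_eq M N" "tensor_eq P Q"
  shows "tensor_eq (M + P) (N + Q)"
  using assms tensor_eq.plus[of M N P] tensor_eq.plus[of P Q N]
  by (metis add.commute tensor_eq.trans)

lemma tensor_eq_neg:
  "tensor_eq M N \<Longrightarrow>
   tensor_eq (image_mset (\<lambda>(a, b). (- a, b)) M) (image_mset (\<lambda>(a, b). (- a, b)) N)"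
proof (induction rule: tensor_eq.induct)
  case (add_left a a' b)
  then show ?case using tensor_eq.add_left[of "- a" "- a'" b] by simp
next
  case (scale c a b)
  then show ?case using tensor_eq.scale[of c "- a" b] by simp
qed (auto intro: tensor_eq.intros)

lemma tensor_eq_cancel:
  "tensor_eq (image_mset (\<lambda>(a, b). (- a, b)) M + M) {#}"
proof (induction M)
  case empty
  then show ?case by (simp add: tensor_eq.refl)
next
  case (add x M)
  obtain a b where x: "x = (a, b)" by fastforce
  have "tensor_eq {#(- a, b), (a, b)#} {#}"
    using tensor_eq.add_left[of "- a" a b] tensor_eq.zero[of b]
    by (metis add.left_inverse tensor_eq.sym tensor_eq.trans)
  from tensor_eq_plus2[OF this add] show ?case by (simp add: x add_mset_commute)
qed

instantiation tensor :: (complex_vs, complex_vs) ab_group_add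
begin
lift_definition zero_tensor :: "'a \<otimes> 'b" is "{#}" .
lift_definition plus_tensor :: "'a \<otimes> 'b \<Rightarrow> 'a \<otimes> 'b \<Rightarrow> 'a \<otimes> 'b" is "(+)"
  by (rule tensor_eq_plus2)
lift_definition uminus_tensor :: "'a \<otimes> 'b \<Rightarrow> 'a \<otimes> 'b" is "image_mset (\<lambda>(a, b). (- a, b))"
  by (rule tensor_eq_neg)
definition minus_tensor :: "'a \<otimes> 'b \<Rightarrow> 'a \<otimes> 'b \<Rightarrow> 'a \<otimes> 'b" where "minus_tensor x y = x + - y"
instance
proof
  fix a b c :: "'a \<otimes> 'b"
  show "a + b + c = a + (b + c)" by transfer (simp add: tensor_eq.refl add.assoc)
  show "a + b = b + a" by transfer (simp add: tensor_eq.refl add.commute)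
  show "0 + a = a" by transfer (simp add: tensor_eq.refl)
  show "- a + a = 0" by transfer (rule tensor_eq_cancel)
  show "a - b = a + - b" by (rule minus_tensor_def)
qed
end

definition tensor_lift :: "('a::complex_vs \<Rightarrow> 'b::complex_vs \<Rightarrow> 'c::ab_group_add) \<Rightarrow> 'a \<otimes> 'b \<Rightarrow> 'c" where
  "tensor_lift \<beta> t = (\<Sum>(a, b)\<in>#rep_tensor t. \<beta> a b)"

text \<open>Biadditive and balanced maps are the ones that factor through the tensor product. This covers
  complex bilinear maps, and also the conjugate-bilinear map behind the involution.\<close>

definition balanced :: "('a::complex_vs \<Rightarrow> 'b::complex_vs \<Rightarrow> 'c::ab_group_add) \<Rightarrow> bool" where
  "balanced \<beta> \<longleftrightarrow>
     (\<forall>a a' b. \<beta> (a + a') b = \<beta> a b + \<beta> a' b) \<and>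
     (\<forall>a b b'. \<beta> a (b + b') = \<beta> a b + \<beta> a b') \<and>
     (\<forall>c a b. \<beta> (c *\<^sub>C a) b = \<beta> a (c *\<^sub>C b))"

lemma balancedI:
  assumes "\<And>a a' b. \<beta> (a + a') b = \<beta> a b + \<beta> a' b" "\<And>a b b'. \<beta> a (b + b') = \<beta> a b + \<beta> a b'"
    "\<And>c a b. \<beta> (c *\<^sub>C a) b = \<beta> a (c *\<^sub>C b)"
  shows "balanced \<beta>"
  using assms unfolding balanced_def by blast

lemma balanced_sum_mset:
  assumes "balanced \<beta>" and "tensor_eq M N"
  shows "(\<Sum>(a, b)\<in>#M. \<beta> a b) = (\<Sum>(a, b)\<in>#N. \<beta> a b)"
  using assms(2)
proof (induction rule: tensor_eq.induct)
  case (zero b)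
  have "\<beta> (0 + 0) b = \<beta> 0 b + \<beta> 0 b" using assms(1) unfolding balanced_def by blast
  then show ?case by simp
qed (use assms(1) in \<open>auto simp: balanced_def\<close>)

lemma tensor_eq_rep_abs: "tensor_eq (rep_tensor (abs_tensor M)) M"
  by (rule Quotient_rep_abs[OF Quotient_tensor tensor_eq.refl])

lemma abs_rep_tensor: "abs_tensor (rep_tensor x) = x"
  by (rule Quotient_abs_rep[OF Quotient_tensor])

lemma tensor_lift_pure:
  assumes "balanced \<beta>"
  shows "tensor_lift \<beta> (a \<otimes> b) = \<beta> a b"
proof -
  have "tensor_eq (rep_tensor (a \<otimes> b)) {#(a, b)#}"
    unfolding pure_tensor_def by (simp add: tensor_eq_rep_abs)
  from balanced_sum_mset[OF assms this] show ?thesis by (simp add: tensor_lift_def)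
qed

lemma tensor_lift_add:
  assumes "balanced \<beta>"
  shows "tensor_lift \<beta> (x + y) = tensor_lift \<beta> x + tensor_lift \<beta> y"
proof -
  have "tensor_eq (rep_tensor (x + y)) (rep_tensor x + rep_tensor y)"
    using tensor_eq_rep_abs[of "rep_tensor x + rep_tensor y"]
    by (simp flip: plus_tensor.abs_eq add: abs_rep_tensor)
  from balanced_sum_mset[OF assms this] show ?thesis by (simp add: tensor_lift_def)
qed

lemma tensor_lift_zero [simp]: "balanced \<beta> \<Longrightarrow> tensor_lift \<beta> 0 = 0"
  using tensor_lift_add[of \<beta> 0 0] by simp

lemma tensor_induct [case_names zero add]:
  assumes "P 0" and "\<And>a b x. P x \<Longrightarrow> P (a \<otimes> b + x)"
  shows "P x"
proof -
  have "P (abs_tensor M)" for M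
  proof (induction M)
    case empty
    then show ?case using assms(1) by (simp add: zero_tensor_def)
  next
    case (add p M)
    obtain a b where p: "p = (a, b)" by fastforce
    have "abs_tensor (add_mset p M) = a \<otimes> b + abs_tensor M"
      by (simp add: p pure_tensor.abs_eq plus_tensor.abs_eq)
    then show ?case using assms(2) add by simp
  qed
  then show ?thesis by (metis abs_rep_tensor)
qed

lemma pure_add_left: "(a + a') \<otimes> b = a \<otimes> b + a' \<otimes> b"
  by transfer (use tensor_eq.add_left in \<open>simp add: add_mset_commute\<close>)

lemma pure_add_right: "a \<otimes> (b + b') = a \<otimes> b + a \<otimes> b'"
  by transfer (use tensor_eq.add_right in \<open>simp add: add_mset_commute\<close>)

lemma pure_balanced: "(c *\<^sub>C a) \<otimes> b = a \<otimes> (c *\<^sub>C b)"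
  by transfer (rule tensor_eq.scale)

lemma balanced_lift_fun:
  assumes "\<And>a b. balanced (\<gamma> a b)" and "\<And>c d. balanced (\<lambda>a b. \<gamma> a b c d)"
  shows "balanced (\<lambda>a b. tensor_lift (\<gamma> a b) y)"
proof (rule balancedI)
  fix a a' b b' k
  note simps = tensor_lift_add[OF assms(1)] tensor_lift_zero[OF assms(1)] tensor_lift_pure[OF assms(1)]
  have l: "\<gamma> (a + a') b c d = \<gamma> a b c d + \<gamma> a' b c d"
    and r: "\<gamma> a (b + b') c d = \<gamma> a b c d + \<gamma> a b' c d"
    and s: "\<gamma> (k *\<^sub>C a) b c d = \<gamma> a (k *\<^sub>C b) c d" for a a' b b' c d k
    using assms(2)[of c d] unfolding balanced_def by blast+
  show "tensor_lift (\<gamma> (a + a') b) y = tensor_lift (\<gamma> a b) y + tensor_lift (\<gamma> a' b) y"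
    by (induction y rule: tensor_induct) (simp_all only: simps, simp_all add: l ac_simps)
  show "tensor_lift (\<gamma> a (b + b')) y = tensor_lift (\<gamma> a b) y + tensor_lift (\<gamma> a b') y"
    by (induction y rule: tensor_induct) (simp_all only: simps, simp_all add: r ac_simps)
  show "tensor_lift (\<gamma> (k *\<^sub>C a) b) y = tensor_lift (\<gamma> a (k *\<^sub>C b)) y"
    by (induction y rule: tensor_induct) (simp_all only: simps, simp_all add: s)
qed

instantiation tensor :: (complex_vs, complex_vs) complex_vs
begin
definition scaleC_tensor :: "complex \<Rightarrow> 'a \<otimes> 'b \<Rightarrow> 'a \<otimes> 'b" where
  "scaleC_tensor c = tensor_lift (\<lambda>a b. (c *\<^sub>C a) \<otimes> b)"

lemma balanced_scale: "balanced (\<lambda>a b. (c *\<^sub>C a) \<otimes> b :: 'a \<otimes> 'b)"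
  by (rule balancedI)
     (simp_all add: scaleC_add_right pure_add_left pure_add_right pure_balanced complex_vs.scale_left_commute)

instance
proof
  fix c d :: complex and x y :: "'a \<otimes> 'b"
  have sp: "c *\<^sub>C (a \<otimes> b) = (c *\<^sub>C a) \<otimes> b" for c and a :: 'a and b :: 'b
    by (simp add: scaleC_tensor_def tensor_lift_pure[OF balanced_scale])
  have sa: "c *\<^sub>C (x + y) = c *\<^sub>C x + c *\<^sub>C y" for c and x y :: "'a \<otimes> 'b"
    by (simp add: scaleC_tensor_def tensor_lift_add[OF balanced_scale])
  have sz: "c *\<^sub>C (0 :: 'a \<otimes> 'b) = 0" for c
    by (simp add: scaleC_tensor_def tensor_lift_zero[OF balanced_scale])
  show "c *\<^sub>C (x + y) = c *\<^sub>C x + c *\<^sub>C y" by (rule sa)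
  show "(c + d) *\<^sub>C x = c *\<^sub>C x + d *\<^sub>C x"
    by (induction x rule: tensor_induct) (simp_all add: sp sa sz scaleC_add_left pure_add_left algebra_simps)
  show "c *\<^sub>C d *\<^sub>C x = (c * d) *\<^sub>C x"
    by (induction x rule: tensor_induct) (simp_all add: sp sa sz scaleC_scaleC)
  show "1 *\<^sub>C x = x"
    by (induction x rule: tensor_induct) (simp_all add: sp sa sz scaleC_one)
qed
end

lemma scaleC_pure: "c *\<^sub>C (a \<otimes> b) = (c *\<^sub>C a) \<otimes> b"
  by (simp add: scaleC_tensor_def tensor_lift_pure[OF balanced_scale])

instantiation tensor :: (star_algebra, star_algebra) star_algebra
begin

definition one_tensor :: "'a \<otimes> 'b" where "one_tensor = 1 \<otimes> 1"

definition times_tensor :: "'a \<otimes> 'b \<Rightarrow> 'a \<otimes> 'b \<Rightarrow> 'a \<otimes> 'b" where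
  "times_tensor x y = tensor_lift (\<lambda>a b. tensor_lift (\<lambda>c d. (a * c) \<otimes> (b * d)) y) x"

definition star_tensor :: "'a \<otimes> 'b \<Rightarrow> 'a \<otimes> 'b" where
  "star_tensor = tensor_lift (\<lambda>a b. a\<^sup>\<star> \<otimes> b\<^sup>\<star>)"

lemma balanced_times1: "balanced (\<lambda>c d. (a * c) \<otimes> (b * d) :: 'a \<otimes> 'b)"
  by (rule balancedI)
     (simp_all add: distrib_left pure_add_left pure_add_right mult_scaleC_right pure_balanced)

lemma balanced_times2: "balanced (\<lambda>a b. (a * c) \<otimes> (b * d) :: 'a \<otimes> 'b)"
  by (rule balancedI)
     (simp_all add: distrib_right pure_add_left pure_add_right mult_scaleC_left pure_balanced)

lemma balanced_times: "balanced (\<lambda>a b. tensor_lift (\<lambda>c d. (a * c) \<otimes> (b * d)) y :: 'a \<otimes> 'b)"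
  by (rule balanced_lift_fun) (rule balanced_times1 balanced_times2)+

lemma balanced_star: "balanced (\<lambda>a b. a\<^sup>\<star> \<otimes> b\<^sup>\<star> :: 'a \<otimes> 'b)"
  by (rule balancedI)
     (simp_all add: star_add star_scaleC pure_add_left pure_add_right pure_balanced)

instance
proof
  fix c :: complex and x y z :: "'a \<otimes> 'b"
  have ml: "(x + y) * z = x * z + y * z" for x y z :: "'a \<otimes> 'b"
    by (simp add: times_tensor_def tensor_lift_add[OF balanced_times])
  have z1: "0 * z = 0" for z :: "'a \<otimes> 'b"
    by (simp add: times_tensor_def tensor_lift_zero[OF balanced_times])
  have pure1: "(a \<otimes> b) * z = tensor_lift (\<lambda>c d. (a * c) \<otimes> (b * d)) z" for a b and z :: "'a \<otimes> 'b"
    by (simp add: times_tensor_def tensor_lift_pure[OF balanced_times])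
  have pure: "(a \<otimes> b) * (c \<otimes> d) = (a * c) \<otimes> (b * d)" for a c :: 'a and b d :: 'b
    by (simp add: pure1 tensor_lift_pure[OF balanced_times1])
  have mr1: "(a \<otimes> b) * (y + z) = (a \<otimes> b) * y + (a \<otimes> b) * z" for a b and y z :: "'a \<otimes> 'b"
    by (simp add: pure1 tensor_lift_add[OF balanced_times1])
  have zr1: "(a \<otimes> b) * 0 = (0 :: 'a \<otimes> 'b)" for a b
    by (simp add: pure1 tensor_lift_zero[OF balanced_times1])
  have mr: "x * (y + z) = x * y + x * z" for x y z :: "'a \<otimes> 'b"
    by (induction x rule: tensor_induct) (simp_all add: ml z1 mr1 algebra_simps)
  have z2: "x * 0 = 0" for x :: "'a \<otimes> 'b"
    by (induction x rule: tensor_induct) (simp_all add: ml z1 zr1)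
  note simps = ml mr z1 z2 pure
  show "(x + y) * z = x * z + y * z" by (rule ml)
  show "x * (y + z) = x * y + x * z" by (rule mr)
  have as2: "(a \<otimes> b) * (c \<otimes> d) * z = (a \<otimes> b) * ((c \<otimes> d) * z)" for a c b d and z :: "'a \<otimes> 'b"
    by (induction z rule: tensor_induct) (simp_all add: simps mult.assoc)
  have as1: "(a \<otimes> b) * y * z = (a \<otimes> b) * (y * z)" for a b and y z :: "'a \<otimes> 'b"
    by (induction y rule: tensor_induct) (simp_all only: simps as2[unfolded pure])
  show "x * y * z = x * (y * z)"
    by (induction x rule: tensor_induct) (simp_all add: ml z1 as1)
  show "1 * x = x"
    by (induction x rule: tensor_induct) (simp_all add: simps one_tensor_def)
  show "x * 1 = x"
    by (induction x rule: tensor_induct) (simp_all add: simps one_tensor_def)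
  have sl1: "(c *\<^sub>C (a \<otimes> b)) * y = c *\<^sub>C ((a \<otimes> b) * y)" for a b and y :: "'a \<otimes> 'b"
    by (induction y rule: tensor_induct)
       (simp_all add: simps scaleC_pure scaleC_add_right mult_scaleC_left)
  show "(c *\<^sub>C x) * y = c *\<^sub>C (x * y)"
    by (induction x rule: tensor_induct) (simp_all add: ml z1 scaleC_add_right sl1)
  have sr1: "(a \<otimes> b) * (c *\<^sub>C y) = c *\<^sub>C ((a \<otimes> b) * y)" for a b and y :: "'a \<otimes> 'b"
    by (induction y rule: tensor_induct)
       (simp_all add: simps scaleC_pure scaleC_add_right mult_scaleC_right)
  show "x * (c *\<^sub>C y) = c *\<^sub>C (x * y)"
    by (induction x rule: tensor_induct) (simp_all add: ml z1 scaleC_add_right sr1)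
  have sa: "(x + y)\<^sup>\<star> = x\<^sup>\<star> + y\<^sup>\<star>" for x y :: "'a \<otimes> 'b"
    by (simp add: star_tensor_def tensor_lift_add[OF balanced_star])
  have sz: "(0 :: 'a \<otimes> 'b)\<^sup>\<star> = 0"
    by (simp add: star_tensor_def tensor_lift_zero[OF balanced_star])
  have sp: "(a \<otimes> b)\<^sup>\<star> = a\<^sup>\<star> \<otimes> b\<^sup>\<star>" for a :: 'a and b :: 'b
    by (simp add: star_tensor_def tensor_lift_pure[OF balanced_star])
  show "(x + y)\<^sup>\<star> = x\<^sup>\<star> + y\<^sup>\<star>" by (rule sa)
  show "(c *\<^sub>C x)\<^sup>\<star> = cnj c *\<^sub>C x\<^sup>\<star>"
    by (induction x rule: tensor_induct)
       (simp_all add: sa sz sp scaleC_add_right scaleC_pure star_scaleC)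
  have sm1: "((a \<otimes> b) * y)\<^sup>\<star> = y\<^sup>\<star> * (a \<otimes> b)\<^sup>\<star>" for a b and y :: "'a \<otimes> 'b"
    by (induction y rule: tensor_induct) (simp_all add: simps sa sz sp star_mult)
  show "(x * y)\<^sup>\<star> = y\<^sup>\<star> * x\<^sup>\<star>"
    by (induction x rule: tensor_induct) (simp_all add: ml mr z1 z2 sa sz sm1)
  show "(x\<^sup>\<star>)\<^sup>\<star> = x"
    by (induction x rule: tensor_induct) (simp_all add: sa sz sp star_star)
qed
end

definition tensor_map ::
  "('a::complex_vs \<Rightarrow> 'c::complex_vs) \<Rightarrow> ('b::complex_vs \<Rightarrow> 'd::complex_vs) \<Rightarrow> 'a \<otimes> 'b \<Rightarrow> 'c \<otimes> 'd" where
  "tensor_map f g = tensor_lift (\<lambda>a b. f a \<otimes> g b)"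

definition tensor_assoc ::
  "('a::complex_vs \<otimes> 'b::complex_vs) \<otimes> 'c::complex_vs \<Rightarrow> 'a \<otimes> 'b \<otimes> 'c" where
  "tensor_assoc = tensor_lift (\<lambda>x c. tensor_lift (\<lambda>a b. a \<otimes> b \<otimes> c) x)"

text \<open>The slice maps \<open>\<phi> \<otimes> id\<close> and \<open>id \<otimes> \<phi>\<close>.\<close>

definition slice_fst :: "('a::complex_vs \<Rightarrow> complex) \<Rightarrow> 'a \<otimes> 'b::complex_vs \<Rightarrow> 'b" where
  "slice_fst \<phi> = tensor_lift (\<lambda>a b. \<phi> a *\<^sub>C b)"

definition slice_snd :: "('b::complex_vs \<Rightarrow> complex) \<Rightarrow> 'a::complex_vs \<otimes> 'b \<Rightarrow> 'a" where
  "slice_snd \<phi> = tensor_lift (\<lambda>a b. \<phi> b *\<^sub>C a)"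

section \<open>Compact quantum groups\<close>

class cstar_algebra = star_algebra + real_normed_algebra + banach +
  assumes scaleR_eq_scaleC: "r *\<^sub>R x = complex_of_real r *\<^sub>C x"
    and norm_scaleC: "norm (c *\<^sub>C x) = cmod c * norm x"
    and cstar_identity: "norm (x\<^sup>\<star> * x) = (norm x)\<^sup>2"

definition cstar_norm :: "('a::star_algebra \<Rightarrow> real) \<Rightarrow> bool" where
  "cstar_norm N \<longleftrightarrow>
     (\<forall>x. 0 \<le> N x) \<and> (\<forall>x. N x = 0 \<longleftrightarrow> x = 0) \<and>
     (\<forall>c x. N (c *\<^sub>C x) = cmod c * N x) \<and> (\<forall>x y. N (x + y) \<le> N x + N y) \<and>
     (\<forall>x y. N (x * y) \<le> N x * N y) \<and> (\<forall>x. N (x\<^sup>\<star> * x) = (N x)\<^sup>2)"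

text \<open>A C*-algebra is a minimal tensor product of two others, via \<open>\<tau>\<close>, if it is a completion of
  their algebraic tensor product in the smallest C*-norm.\<close>

definition min_tensor ::
  "('a::cstar_algebra \<otimes> 'b::cstar_algebra \<Rightarrow> 't::cstar_algebra) \<Rightarrow> bool" where
  "min_tensor \<tau> \<longleftrightarrow>
     star_hom \<tau> \<and> inj \<tau> \<and> closure (range \<tau>) = UNIV \<and>
     (\<forall>N. cstar_norm N \<longrightarrow> (\<forall>x. norm (\<tau> x) \<le> N x))"

text \<open>\<open>F\<close> is the (necessarily unique) continuous linear extension of \<open>a \<otimes> b \<mapsto> \<beta> a b\<close>
  to the completed tensor product.\<close>

definition tensor_extension ::
  "('a::cstar_algebra \<otimes> 'b::cstar_algebra \<Rightarrow> 't::cstar_algebra) \<Rightarrow>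
   ('a \<Rightarrow> 'b \<Rightarrow> 'c::cstar_algebra) \<Rightarrow> ('t \<Rightarrow> 'c) \<Rightarrow> bool" where
  "tensor_extension \<tau> \<beta> F \<longleftrightarrow> bounded_linear F \<and> (\<forall>a b. F (\<tau> (a \<otimes> b)) = \<beta> a b)"

text \<open>A unital C*-algebra \<open>'c\<close> with comultiplication \<open>\<Delta>\<close>. The type \<open>'t\<close> is its minimal tensor
  square, via \<open>\<tau>\<close>, and \<open>'t3\<close> its minimal tensor cube, presented both as the tensor product of \<open>'t\<close>
  and \<open>'c\<close> and as that of \<open>'c\<close> and \<open>'t\<close>.\<close>

locale compact_quantum_group =
  fixes \<tau> :: "'c::cstar_algebra \<otimes> 'c \<Rightarrow> 't::cstar_algebra"
    and \<theta>\<^sub>1 :: "'t \<otimes> 'c \<Rightarrow> 't3::cstar_algebra"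
    and \<theta>\<^sub>2 :: "'c \<otimes> 't \<Rightarrow> 't3"
    and \<Delta> :: "'c \<Rightarrow> 't"
  assumes min_tensor_square: "min_tensor \<tau>"
    and min_tensor_cube: "min_tensor \<theta>\<^sub>1" "min_tensor \<theta>\<^sub>2"
    and cube_assoc: "\<theta>\<^sub>1 (\<tau> (a \<otimes> b) \<otimes> c) = \<theta>\<^sub>2 (a \<otimes> \<tau> (b \<otimes> c))"
    and comult_hom: "star_hom \<Delta>"
    and coassoc: "\<exists>L R. tensor_extension \<tau> (\<lambda>a b. \<theta>\<^sub>1 (\<Delta> a \<otimes> b)) L \<and>
                        tensor_extension \<tau> (\<lambda>a b. \<theta>\<^sub>2 (a \<otimes> \<Delta> b)) R \<and> L \<circ> \<Delta> = R \<circ> \<Delta>"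
    and cancellation_left: "closure (complex_vs.span {\<Delta> a * \<tau> (b \<otimes> 1) |a b. True}) = UNIV"
    and cancellation_right: "closure (complex_vs.span {\<Delta> a * \<tau> (1 \<otimes> b) |a b. True}) = UNIV"

definition haar_state ::
  "('c::cstar_algebra \<otimes> 'c \<Rightarrow> 't::cstar_algebra) \<Rightarrow> ('c \<Rightarrow> 't) \<Rightarrow> ('c \<Rightarrow> complex) \<Rightarrow> bool" where
  "haar_state \<tau> \<Delta> h \<longleftrightarrow> state h \<and>
     (\<exists>L R. tensor_extension \<tau> (\<lambda>a b. h a *\<^sub>C b) L \<and> tensor_extension \<tau> (\<lambda>a b. h b *\<^sub>C a) R \<and>
            (\<forall>a. L (\<Delta> a) = h a *\<^sub>C 1 \<and> R (\<Delta> a) = h a *\<^sub>C 1))"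

text \<open>An \<open>n\<close>-dimensional corepresentation is a matrix with entries \<open>u i j\<close> for \<open>i, j < n\<close>.\<close>

definition unitary_corep ::
  "('c::cstar_algebra \<otimes> 'c \<Rightarrow> 't::cstar_algebra) \<Rightarrow> ('c \<Rightarrow> 't) \<Rightarrow> nat \<Rightarrow> (nat \<Rightarrow> nat \<Rightarrow> 'c) \<Rightarrow> bool" where
  "unitary_corep \<tau> \<Delta> n u \<longleftrightarrow>
     (\<forall>i<n. \<forall>j<n. \<Delta> (u i j) = (\<Sum>k<n. \<tau> (u i k \<otimes> u k j)) \<and>
        (\<Sum>k<n. u i k * (u j k)\<^sup>\<star>) = (if i = j then 1 else 0) \<and>
        (\<Sum>k<n. (u k i)\<^sup>\<star> * u k j) = (if i = j then 1 else 0))"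

definition Pol ::
  "('c::cstar_algebra \<otimes> 'c \<Rightarrow> 't::cstar_algebra) \<Rightarrow> ('c \<Rightarrow> 't) \<Rightarrow> 'c set" where
  "Pol \<tau> \<Delta> = complex_vs.span {u i j |n u i j. unitary_corep \<tau> \<Delta> n u \<and> i < n \<and> j < n}"

section \<open>The Hopf *-algebra of a compact quantum group\<close>

definition hopf_star_algebra ::
  "('a::star_algebra \<Rightarrow> 'a \<otimes> 'a) \<Rightarrow> ('a \<Rightarrow> complex) \<Rightarrow> ('a \<Rightarrow> 'a) \<Rightarrow> bool" where
  "hopf_star_algebra \<Delta> \<epsilon> S \<longleftrightarrow>
     star_hom \<Delta> \<and> alg_hom \<epsilon> \<and> clinear S \<and>
     (\<forall>a. tensor_assoc (tensor_map \<Delta> id (\<Delta> a)) = tensor_map id \<Delta> (\<Delta> a)) \<and>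
     (\<forall>a. slice_fst \<epsilon> (\<Delta> a) = a \<and> slice_snd \<epsilon> (\<Delta> a) = a) \<and>
     (\<forall>a. tensor_lift (\<lambda>x y. S x * y) (\<Delta> a) = \<epsilon> a *\<^sub>C 1 \<and>
          tensor_lift (\<lambda>x y. x * S y) (\<Delta> a) = \<epsilon> a *\<^sub>C 1)"

text \<open>The type \<open>'a\<close> is a copy, via \<open>\<iota>\<close>, of the *-subalgebra \<open>Pol \<tau> \<Delta>\<close> of \<open>'c\<close>, and
  \<open>\<delta>\<close> is the restriction of \<open>\<Delta>\<close> to it.\<close>

definition pol_hopf_algebra ::
  "('c::cstar_algebra \<otimes> 'c \<Rightarrow> 't::cstar_algebra) \<Rightarrow> ('c \<Rightarrow> 't) \<Rightarrow> ('a::star_algebra \<Rightarrow> 'c) \<Rightarrow>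
   ('a \<Rightarrow> 'a \<otimes> 'a) \<Rightarrow> ('a \<Rightarrow> complex) \<Rightarrow> ('a \<Rightarrow> 'a) \<Rightarrow> bool" where
  "pol_hopf_algebra \<tau> \<Delta> \<iota> \<delta> \<epsilon> S \<longleftrightarrow>
     star_hom \<iota> \<and> inj \<iota> \<and> range \<iota> = Pol \<tau> \<Delta> \<and>
     (\<forall>a. \<tau> (tensor_map \<iota> \<iota> (\<delta> a)) = \<Delta> (\<iota> a)) \<and> hopf_star_algebra \<delta> \<epsilon> S"

definition conv ::
  "('a::star_algebra \<Rightarrow> 'a \<otimes> 'a) \<Rightarrow> ('a \<Rightarrow> complex) \<Rightarrow> ('a \<Rightarrow> complex) \<Rightarrow> 'a \<Rightarrow> complex" where
  "conv \<delta> \<phi> \<psi> a = tensor_lift (\<lambda>x y. \<phi> x * \<psi> y) (\<delta> a)"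

text \<open>The actions \<open>\<phi> \<star> a = (id \<otimes> \<phi>) (\<delta> a)\<close> and \<open>a \<star> \<phi> = (\<phi> \<otimes> id) (\<delta> a)\<close>: the functional on the
  left of the convolution sign is evaluated on the second leg.\<close>

definition lconv :: "('a::star_algebra \<Rightarrow> 'a \<otimes> 'a) \<Rightarrow> ('a \<Rightarrow> complex) \<Rightarrow> 'a \<Rightarrow> 'a" where
  "lconv \<delta> \<phi> a = slice_snd \<phi> (\<delta> a)"

definition rconv :: "('a::star_algebra \<Rightarrow> 'a \<otimes> 'a) \<Rightarrow> 'a \<Rightarrow> ('a \<Rightarrow> complex) \<Rightarrow> 'a" where
  "rconv \<delta> a \<phi> = slice_fst \<phi> (\<delta> a)"

definition woronowicz_characters ::
  "('a::star_algebra \<Rightarrow> 'a \<otimes> 'a) \<Rightarrow> ('a \<Rightarrow> complex) \<Rightarrow> ('a \<Rightarrow> 'a) \<Rightarrow> ('a \<Rightarrow> complex) \<Rightarrow>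
   (complex \<Rightarrow> 'a \<Rightarrow> complex) \<Rightarrow> bool" where
  "woronowicz_characters \<delta> \<epsilon> S h f \<longleftrightarrow>
     (\<forall>z. alg_hom (f z)) \<and>
     (\<forall>a. (\<lambda>z. f z a) holomorphic_on UNIV) \<and>
     f 0 = \<epsilon> \<and>
     (\<forall>z w. conv \<delta> (f z) (f w) = f (z + w)) \<and>
     (\<forall>z a. f z (S a) = f (- z) a) \<and>
     (\<forall>z a. f (cnj z) (a\<^sup>\<star>) = cnj (f (- z) a)) \<and>
     (\<forall>a. S (S a) = rconv \<delta> (lconv \<delta> (f (- 1)) a) (f 1)) \<and>
     (\<forall>a b. h (a * b) = h (b * rconv \<delta> (lconv \<delta> (f 1) a) (f 1)))"

definition kac_type :: "('a \<Rightarrow> 'a) \<Rightarrow> bool" where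
  "kac_type S \<longleftrightarrow> S \<circ> S = id"

definition twisted_antipode ::
  "('a::star_algebra \<Rightarrow> 'a \<otimes> 'a) \<Rightarrow> ('a \<Rightarrow> 'a) \<Rightarrow> (complex \<Rightarrow> 'a \<Rightarrow> complex) \<Rightarrow> 'a \<Rightarrow> 'a" where
  "twisted_antipode \<delta> S f a = lconv \<delta> (f 1) (S a)"

definition twisted_ad ::
  "('a::star_algebra \<Rightarrow> 'a \<otimes> 'a) \<Rightarrow> ('a \<Rightarrow> 'a) \<Rightarrow> (complex \<Rightarrow> 'a \<Rightarrow> complex) \<Rightarrow> 'a \<Rightarrow> 'a \<otimes> 'a" where
  "twisted_ad \<delta> S f a =
     tensor_lift (\<lambda>t z. tensor_lift (\<lambda>x y. (x * twisted_antipode \<delta> S f z) \<otimes> y) t)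
       (tensor_map \<delta> id (\<delta> a))"

definition twisted_ad_h ::
  "('a::star_algebra \<Rightarrow> 'a \<otimes> 'a) \<Rightarrow> ('a \<Rightarrow> 'a) \<Rightarrow> (complex \<Rightarrow> 'a \<Rightarrow> complex) \<Rightarrow> ('a \<Rightarrow> complex) \<Rightarrow>
   'a \<Rightarrow> 'a" where
  "twisted_ad_h \<delta> S f h a = slice_fst h (twisted_ad \<delta> S f a)"

end

theory Submission
  imports Defs
begin

text \<open>The proof works with coefficients of unitary corepresentations, since they span the Hopf
  *-algebra. If \<open>v\<close> is a unitary corepresentation, then \<open>\<delta> (v i j) = (\<Sum>k. v i k \<otimes> v k j)\<close> and
  \<open>S (v i j) = (v j i)\<^sup>\<star>\<close>, so every Sweedler formula becomes a finite sum over matrix indices.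

  \<^bold>\<open>Positivity.\<close> Let \<open>\<sigma>(a) = f\<^sub>1 \<star> a \<star> f\<^sub>1\<close>, so that \<open>h(ab) = h(b \<sigma>(a))\<close>, and write \<open>T\<close> for the twisted
  antipode. The twist is chosen such that \<open>\<sigma>(T(c)\<^sup>\<star>) = T(c\<^sup>\<star>)\<close>
  (\<open>modular_star_twisted_antipode\<close>), whence \<open>h(x T(c\<^sup>\<star>)) = h(T(c)\<^sup>\<star> x)\<close>. As \<open>T\<close> reverses
  products, the scalar \<open>h(a\<^sub>1\<^sup>\<star> b\<^sub>1 T(a\<^sub>3\<^sup>\<star> b\<^sub>3))\<close> in the image of \<open>a\<^sup>\<star> b\<close> equals
  \<open>h((a\<^sub>1 T(a\<^sub>3))\<^sup>\<star> (b\<^sub>1 T(b\<^sub>3)))\<close>, which gives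
  \<open>(h \<otimes> id) ((ad a)\<^sup>\<star> (ad b))\<close>. For \<open>a = b\<close> this is a sum of squares by Gram-Schmidt
  orthogonalisation of the first legs with respect to \<open>h\<close> (\<open>slice_fst_square\<close>).

  \<^bold>\<open>Kac type.\<close> If \<open>S\<^sup>2 = id\<close>, then \<open>f\<^sub>1\<close> is central for convolution. The modular property, applied to
  \<open>h(a\<^sub>1 S(a\<^sub>2)) = \<epsilon>(a)\<close>, then gives \<open>f\<^sub>2 = \<epsilon>\<close> (\<open>kac_character_two\<close>). Since \<open>f\<^sub>1(v)\<close> is
  the square of the hermitian matrix \<open>f\<^sub>1\<^sub>/\<^sub>2(v)\<close> and squares to \<open>f\<^sub>2(v) = 1\<close>, it is \<open>1\<close>, and the twist
  disappears (\<open>kac_character_one\<close>). For the untwisted action idempotence is the identity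
  \<open>h(a\<^sub>1 S(a\<^sub>5)) h(a\<^sub>2 S(a\<^sub>4)) a\<^sub>3 = h(a\<^sub>1 S(a\<^sub>3)) a\<^sub>2\<close>, which is invariance of \<open>h\<close>
  (\<open>state_invariant_coefficients\<close>).\<close>

section \<open>Linear maps and the tensor product\<close>

interpretation clin: vector_space_pair
  "scaleC :: complex \<Rightarrow> 'a \<Rightarrow> 'a :: complex_vs" "scaleC :: complex \<Rightarrow> 'b \<Rightarrow> 'b :: complex_vs"
  by unfold_locales

lemma clinearI:
  assumes "\<And>x y. g (x + y) = g x + g y" "\<And>c x. g (c *\<^sub>C x) = c *\<^sub>C g x"
  shows "clinear g"
  using assms by (simp add: Vector_Spaces.linear_iff complex_vs.vector_space_axioms)

lemma clinear_add: "clinear g \<Longrightarrow> g (x + y) = g x + g y"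
  and clinear_scale: "clinear g \<Longrightarrow> g (c *\<^sub>C x) = c *\<^sub>C g x"
  by (simp_all add: Vector_Spaces.linear_iff)

lemma clinear_zero: "clinear g \<Longrightarrow> g 0 = 0"
  by (rule clin.linear_0)

lemma clinear_diff: "clinear g \<Longrightarrow> g (x - y) = g x - g y"
  by (rule clin.linear_diff)

lemma clinear_sum: "clinear g \<Longrightarrow> g (\<Sum>k\<in>K. x k) = (\<Sum>k\<in>K. g (x k))"
  by (rule clin.linear_sum)

lemma clinear_comp: "clinear g \<Longrightarrow> clinear k \<Longrightarrow> clinear (k \<circ> g)"
  by (simp add: Vector_Spaces.linear_iff)

lemma clinear_functional_scale: "clinear \<phi> \<Longrightarrow> \<phi> (c *\<^sub>C x) = c * \<phi> x"
  by (simp add: clinear_scale scaleC_complex_def)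

lemma scaleC_sum_left: "(\<Sum>k\<in>K. c k) *\<^sub>C x = (\<Sum>k\<in>K. c k *\<^sub>C x)"
  by (rule complex_vs.scale_sum_left)

lemma scaleC_sum_right: "c *\<^sub>C (\<Sum>k\<in>K. x k) = (\<Sum>k\<in>K. c *\<^sub>C x k)"
  by (rule complex_vs.scale_sum_right)

lemma star_zero [simp]: "(0::'a::star_algebra)\<^sup>\<star> = 0"
  using star_add[of "0::'a" 0] by simp

lemma star_sum: "(\<Sum>k\<in>K. x k)\<^sup>\<star> = (\<Sum>k\<in>K. (x k)\<^sup>\<star> :: 'a::star_algebra)"
  by (induction K rule: infinite_finite_induct) (simp_all add: star_add)

lemma star_one [simp]: "(1::'a::star_algebra)\<^sup>\<star> = 1"
  by (metis mult_1 star_mult star_star mult_1_right)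

lemma tensor_lift_sum_pure:
  assumes "balanced \<beta>"
  shows "tensor_lift \<beta> (\<Sum>k\<in>K. x k \<otimes> y k) = (\<Sum>k\<in>K. \<beta> (x k) (y k))"
  by (induction K rule: infinite_finite_induct)
     (simp_all add: assms tensor_lift_add tensor_lift_pure)

text \<open>Maps on a threefold tensor product \<open>(A \<otimes> B) \<otimes> C\<close> are given by nested lifts. This is the
  condition under which the outer lift is well defined.\<close>

lemma balanced_lift_nested:
  assumes "\<And>z. balanced (\<lambda>x y. \<gamma> x y z)"
    and "\<And>x y z z'. \<gamma> x y (z + z') = \<gamma> x y z + \<gamma> x y z'"
    and "\<And>c x y z. \<gamma> (c *\<^sub>C x) y z = \<gamma> x y (c *\<^sub>C z)"
  shows "balanced (\<lambda>t z. tensor_lift (\<lambda>x y. \<gamma> x y z) t)"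
proof (rule balancedI)
  note simps = tensor_lift_add[OF assms(1)] tensor_lift_zero[OF assms(1)] tensor_lift_pure[OF assms(1)]
  fix t t' z z' c
  show "tensor_lift (\<lambda>x y. \<gamma> x y z) (t + t')
      = tensor_lift (\<lambda>x y. \<gamma> x y z) t + tensor_lift (\<lambda>x y. \<gamma> x y z) t'"
    by (simp add: simps)
  show "tensor_lift (\<lambda>x y. \<gamma> x y (z + z')) t
      = tensor_lift (\<lambda>x y. \<gamma> x y z) t + tensor_lift (\<lambda>x y. \<gamma> x y z') t"
    by (induction t rule: tensor_induct) (simp_all only: simps, simp_all add: assms(2) ac_simps)
  show "tensor_lift (\<lambda>x y. \<gamma> x y z) (c *\<^sub>C t) = tensor_lift (\<lambda>x y. \<gamma> x y (c *\<^sub>C z)) t"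
    by (induction t rule: tensor_induct)
       (simp_all add: simps scaleC_add_right scaleC_pure assms(3))
qed

lemma additive_tensor_lift:
  assumes "balanced \<beta>" and "\<And>x y. g (x + y) = g x + g y"
  shows "g (tensor_lift \<beta> t) = tensor_lift (\<lambda>a b. g (\<beta> a b)) t"
proof -
  have g0: "g 0 = 0" using assms(2)[of 0 0] by simp
  have b: "balanced (\<lambda>a b. g (\<beta> a b))"
    using assms by (simp add: balanced_def)
  show ?thesis
    by (induction t rule: tensor_induct)
       (simp_all add: g0 assms tensor_lift_add tensor_lift_pure b)
qed

lemma clinear_tensor_lift:
  assumes "balanced \<beta>" and "\<And>c a b. \<beta> (c *\<^sub>C a) b = c *\<^sub>C \<beta> a b"
  shows "clinear (tensor_lift \<beta>)"
proof (rule clinearI)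
  fix c t
  show "tensor_lift \<beta> (c *\<^sub>C t) = c *\<^sub>C tensor_lift \<beta> t"
    by (induction t rule: tensor_induct)
       (simp_all add: assms tensor_lift_add tensor_lift_pure scaleC_add_right scaleC_pure)
qed (simp add: assms tensor_lift_add)

lemma balanced_slice_fst: "clinear \<phi> \<Longrightarrow> balanced (\<lambda>a b. \<phi> a *\<^sub>C b)"
  by (rule balancedI)
     (simp_all add: clinear_add clinear_functional_scale scaleC_add_left scaleC_add_right scaleC_scaleC mult.commute)

lemma balanced_slice_snd: "clinear \<phi> \<Longrightarrow> balanced (\<lambda>a b. \<phi> b *\<^sub>C a)"
  by (rule balancedI)
     (simp_all add: clinear_add clinear_functional_scale scaleC_add_left scaleC_add_right scaleC_scaleC mult.commute)

lemma clinear_slice_fst: "clinear \<phi> \<Longrightarrow> clinear (slice_fst \<phi>)"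
  unfolding slice_fst_def
  by (rule clinear_tensor_lift[OF balanced_slice_fst]) (simp_all add: clinear_functional_scale scaleC_scaleC)

lemma clinear_slice_snd: "clinear \<phi> \<Longrightarrow> clinear (slice_snd \<phi>)"
  unfolding slice_snd_def
  by (rule clinear_tensor_lift[OF balanced_slice_snd]) (simp_all add: scaleC_scaleC mult.commute)

lemma slice_fst_pure: "clinear \<phi> \<Longrightarrow> slice_fst \<phi> (a \<otimes> b) = \<phi> a *\<^sub>C b"
  unfolding slice_fst_def by (rule tensor_lift_pure[OF balanced_slice_fst])

lemma slice_snd_pure: "clinear \<phi> \<Longrightarrow> slice_snd \<phi> (a \<otimes> b) = \<phi> b *\<^sub>C a"
  unfolding slice_snd_def by (rule tensor_lift_pure[OF balanced_slice_snd])

lemma balanced_tensor_map: "clinear g \<Longrightarrow> clinear k \<Longrightarrow> balanced (\<lambda>a b. g a \<otimes> k b)"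
  by (rule balancedI)
     (simp_all add: clinear_add clinear_scale pure_add_left pure_add_right pure_balanced)

lemma clinear_tensor_map:
  assumes "clinear g" "clinear k"
  shows "clinear (tensor_map g k)"
  unfolding tensor_map_def
  by (rule clinear_tensor_lift[OF balanced_tensor_map[OF assms]])
     (simp add: assms clinear_scale scaleC_pure)

lemma tensor_map_pure: "clinear g \<Longrightarrow> clinear k \<Longrightarrow> tensor_map g k (a \<otimes> b) = g a \<otimes> k b"
  unfolding tensor_map_def by (rule tensor_lift_pure[OF balanced_tensor_map])

lemma clinear_id: "clinear id"
  by (rule clinearI) simp_all

text \<open>Over a field every injective linear map has a linear retraction, so tensoring it with itself
  preserves injectivity.\<close>

lemma inj_tensor_map:
  assumes "clinear g" "inj g"
  shows "inj (tensor_map g g)"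
proof -
  obtain r where r: "clinear r" "r \<circ> g = id"
    using clin.linear_injective_left_inverse[OF assms] by blast
  have rg: "r (g x) = x" for x using r(2) by (metis comp_apply id_apply)
  have "tensor_map r r (tensor_map g g t) = t" for t
  proof (induction t rule: tensor_induct)
    case zero
    show ?case by (simp add: clinear_zero[OF clinear_tensor_map] assms r)
  next
    case (add a b x)
    then show ?case
      by (simp add: clinear_add[OF clinear_tensor_map] assms r tensor_map_pure rg)
  qed
  then show ?thesis by (metis injI)
qed

lemma tensor_mult_pure: "(a \<otimes> b) * (c \<otimes> d) = (a * c) \<otimes> (b * d :: 'b::star_algebra)"
  for a :: "'a::star_algebra"
  by (simp add: times_tensor_def tensor_lift_pure[OF balanced_times1] tensor_lift_pure[OF balanced_times2])

lemma tensor_star_pure: "(a \<otimes> b)\<^sup>\<star> = a\<^sup>\<star> \<otimes> (b\<^sup>\<star> :: 'b::star_algebra)"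
  for a :: "'a::star_algebra"
  by (simp add: star_tensor_def tensor_lift_pure[OF balanced_star])

lemma tensor_eq_sum_pure: "\<exists>(n::nat) x y. t = (\<Sum>i<n. x i \<otimes> y i)"
proof (induction t rule: tensor_induct)
  case zero
  show ?case by (rule exI[of _ 0]) simp
next
  case (add a b t)
  then obtain n :: nat and x y where t: "t = (\<Sum>i<n. x i \<otimes> y i)" by blast
  have "a \<otimes> b + t = (\<Sum>i<Suc n. (x(n := a)) i \<otimes> (y(n := b)) i)"
    by (simp add: t add.commute)
  then show ?case by blast
qed

section \<open>Positive functionals\<close>

lemma positive_functional_hermitian:
  assumes "positive_functional \<omega>"
  shows "\<omega> (y\<^sup>\<star> * x) = cnj (\<omega> (x\<^sup>\<star> * y))"
proof -
  have lin: "clinear \<omega>" and pos: "\<omega> (a\<^sup>\<star> * a) \<in> \<real>\<^sub>\<ge>\<^sub>0" for a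
    using assms by (auto simp: positive_functional_def)
  have expand: "\<omega> ((x + c *\<^sub>C y)\<^sup>\<star> * (x + c *\<^sub>C y))
      = \<omega> (x\<^sup>\<star> * x) + c * \<omega> (x\<^sup>\<star> * y) + cnj c * \<omega> (y\<^sup>\<star> * x) + cnj c * c * \<omega> (y\<^sup>\<star> * y)" for c
    by (simp add: star_add star_scaleC distrib_left distrib_right mult_scaleC_left mult_scaleC_right
        clinear_add[OF lin] clinear_functional_scale[OF lin] scaleC_scaleC mult_ac add_ac)
  have "Im (\<omega> (a\<^sup>\<star> * a)) = 0" for a using pos[of a] by (simp add: complex_nonneg_Reals_iff)
  from this[of "x + 1 *\<^sub>C y"] this[of "x + \<i> *\<^sub>C y"] this[of x] this[of y]
  show ?thesis unfolding expand by (simp add: complex_eq_iff)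
qed

text \<open>The degenerate case of the Cauchy-Schwarz inequality.\<close>

lemma positive_functional_null:
  assumes "positive_functional \<omega>" and null: "\<omega> (y\<^sup>\<star> * y) = 0"
  shows "\<omega> (y\<^sup>\<star> * x) = 0"
proof (rule ccontr)
  assume ne: "\<omega> (y\<^sup>\<star> * x) \<noteq> 0"
  have lin: "clinear \<omega>" and pos: "\<omega> (a\<^sup>\<star> * a) \<in> \<real>\<^sub>\<ge>\<^sub>0" for a
    using assms by (auto simp: positive_functional_def)
  define q where "q = \<omega> (y\<^sup>\<star> * x)"
  define s where "s = Re (\<omega> (x\<^sup>\<star> * x))"
  have p: "\<omega> (x\<^sup>\<star> * y) = cnj q"
    using positive_functional_hermitian[OF assms(1)] q_def by blast
  have expand: "\<omega> ((x + c *\<^sub>C y)\<^sup>\<star> * (x + c *\<^sub>C y)) = \<omega> (x\<^sup>\<star> * x) + c * cnj q + cnj c * q" for c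
    by (simp add: star_add star_scaleC distrib_left distrib_right mult_scaleC_left mult_scaleC_right
        clinear_add[OF lin] clinear_functional_scale[OF lin] scaleC_scaleC null p flip: q_def)
  define r where "r = (s + 1) / (2 * (cmod q)\<^sup>2)"
  have "0 \<le> Re (\<omega> ((x + (- r * q) *\<^sub>C y)\<^sup>\<star> * (x + (- r * q) *\<^sub>C y)))"
    using pos by (simp add: complex_nonneg_Reals_iff)
  also have "\<dots> = s - 2 * r * (cmod q)\<^sup>2"
    unfolding expand cmod_power2 by (simp add: s_def power2_eq_square algebra_simps)
  also have "\<dots> = - 1" using ne by (simp add: r_def q_def field_simps)
  finally show False by simp
qed

text \<open>Gram-Schmidt orthogonalisation with respect to the semi-inner product
  \<open>(x, y) \<mapsto> \<omega> (x\<^sup>\<star> * y)\<close>: subtracting from all first legs their components along one of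
  them splits off a single square. A null vector has zero components, because division by zero
  gives zero, and it is orthogonal to everything anyway.\<close>

lemma slice_fst_square_sum:
  fixes x :: "nat \<Rightarrow> 'a::star_algebra" and y :: "nat \<Rightarrow> 'b::star_algebra"
  assumes "positive_functional \<omega>"
  shows "\<exists>(m::nat) b. slice_fst \<omega> ((\<Sum>i<n. x i \<otimes> y i)\<^sup>\<star> * (\<Sum>i<n. x i \<otimes> y i))
                 = (\<Sum>i<m. (b i)\<^sup>\<star> * b i)"
proof -
  have lin: "clinear \<omega>" and pos: "\<omega> (a\<^sup>\<star> * a) \<in> \<real>\<^sub>\<ge>\<^sub>0" for a
    using assms by (auto simp: positive_functional_def)
  note sl = clinear_slice_fst[OF lin]
  show ?thesis
  proof (induction n arbitrary: x y)
    case 0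
    show ?case by (rule exI[of _ 0]) (simp add: clinear_zero[OF sl])
  next
    case (Suc n)
    define e where "e = x n"
    define c where "c i = \<omega> (e\<^sup>\<star> * x i) / \<omega> (e\<^sup>\<star> * e)" for i
    define x' where "x' i = x i - c i *\<^sub>C e" for i
    define z where "z = y n + (\<Sum>i<n. c i *\<^sub>C y i)"
    define T where "T = (\<Sum>i<n. x' i \<otimes> y i)"
    have orth: "\<omega> (e\<^sup>\<star> * x' i) = 0" for i
      using positive_functional_null[OF assms, of e "x i"]
      by (auto simp: x'_def c_def right_diff_distrib mult_scaleC_right clinear_diff[OF lin]
          clinear_functional_scale[OF lin])
    then have orth': "\<omega> ((x' i)\<^sup>\<star> * e) = 0" for i
      using positive_functional_hermitian[OF assms, of "x' i" e] by simp
    have "x i \<otimes> y i = x' i \<otimes> y i + e \<otimes> (c i *\<^sub>C y i)" for i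
      by (simp add: x'_def flip: pure_balanced pure_add_left)
    moreover have "e \<otimes> (\<Sum>i<n. c i *\<^sub>C y i) = (\<Sum>i<n. e \<otimes> (c i *\<^sub>C y i))"
      by (rule Modules.additive.sum) (simp add: Modules.additive_def pure_add_right)
    ultimately have split: "(\<Sum>i<Suc n. x i \<otimes> y i) = T + e \<otimes> z"
      by (simp add: T_def z_def pure_add_right sum.distrib e_def add_ac)
    have cross: "slice_fst \<omega> (T\<^sup>\<star> * (e \<otimes> z)) = 0" "slice_fst \<omega> ((e \<otimes> z)\<^sup>\<star> * T) = 0"
      by (simp_all add: T_def star_sum sum_distrib_left sum_distrib_right tensor_star_pure
          tensor_mult_pure clinear_sum[OF sl] slice_fst_pure[OF lin] orth orth')
    define r where "r = Re (\<omega> (e\<^sup>\<star> * e))"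
    have r: "\<omega> (e\<^sup>\<star> * e) = of_real r" "r \<ge> 0"
      using pos[of e] by (auto simp: complex_nonneg_Reals_iff r_def complex_eq_iff)
    have diag: "slice_fst \<omega> ((e \<otimes> z)\<^sup>\<star> * (e \<otimes> z)) = (of_real (sqrt r) *\<^sub>C z)\<^sup>\<star> * (of_real (sqrt r) *\<^sub>C z)"
      using r(2) by (simp add: tensor_star_pure tensor_mult_pure slice_fst_pure[OF lin] r(1) star_scaleC
          mult_scaleC_left mult_scaleC_right scaleC_scaleC flip: of_real_mult)
    obtain m :: nat and b where b: "slice_fst \<omega> (T\<^sup>\<star> * T) = (\<Sum>i<m. (b i)\<^sup>\<star> * b i)"
      using Suc.IH[of x' y] unfolding T_def by blast
    define b' where "b' = b(m := of_real (sqrt r) *\<^sub>C z)"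
    have "slice_fst \<omega> ((T + e \<otimes> z)\<^sup>\<star> * (T + e \<otimes> z)) = (\<Sum>i<Suc m. (b' i)\<^sup>\<star> * b' i)"
      by (simp add: b'_def star_add distrib_left distrib_right clinear_add[OF sl] cross diag b)
    then show ?case unfolding split by blast
  qed
qed

lemma slice_fst_square:
  fixes t :: "'a::star_algebra \<otimes> 'b::star_algebra"
  assumes "positive_functional \<omega>"
  shows "\<exists>(m::nat) b. slice_fst \<omega> (t\<^sup>\<star> * t) = (\<Sum>i<m. (b i)\<^sup>\<star> * b i)"
  using slice_fst_square_sum[OF assms] tensor_eq_sum_pure[of t] by blast

section \<open>Matrices of coefficients\<close>

text \<open>A square matrix over a coalgebra with \<open>\<delta> (v i j) = (\<Sum>k. v i k \<otimes> v k j)\<close>. On its entries the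
  legs of an iterated coproduct are entries of the same matrix, so that identities in Sweedler
  notation become identities between finite sums, and coassociativity becomes the exchange of
  sums. The index set is arbitrary because tensor products of corepresentations are indexed by
  pairs.\<close>

definition corep_matrix :: "('a::complex_vs \<Rightarrow> 'a \<otimes> 'a) \<Rightarrow> 'i set \<Rightarrow> ('i \<Rightarrow> 'i \<Rightarrow> 'a) \<Rightarrow> bool" where
  "corep_matrix \<delta> I v \<longleftrightarrow>
     finite I \<and> (\<forall>i\<in>I. \<forall>j\<in>I. \<delta> (v i j) = (\<Sum>k\<in>I. v i k \<otimes> v k j))"

definition unitary_corep_matrix ::
  "('a::star_algebra \<Rightarrow> 'a \<otimes> 'a) \<Rightarrow> nat \<Rightarrow> (nat \<Rightarrow> nat \<Rightarrow> 'a) \<Rightarrow> bool" where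
  "unitary_corep_matrix \<delta> n v \<longleftrightarrow>
     corep_matrix \<delta> {..<n} v \<and>
     (\<forall>i<n. \<forall>j<n. (\<Sum>k<n. v i k * (v j k)\<^sup>\<star>) = (if i = j then 1 else 0) \<and>
        (\<Sum>k<n. (v k i)\<^sup>\<star> * v k j) = (if i = j then 1 else 0))"

lemma matrix_left_inverse_eq_right_inverse:
  fixes A B C :: "'i \<Rightarrow> 'i \<Rightarrow> 'a::star_algebra"
  assumes "finite I"
    and AB: "\<And>i j. i \<in> I \<Longrightarrow> j \<in> I \<Longrightarrow> (\<Sum>k\<in>I. A i k * B k j) = (if i = j then 1 else 0)"
    and BC: "\<And>i j. i \<in> I \<Longrightarrow> j \<in> I \<Longrightarrow> (\<Sum>k\<in>I. B i k * C k j) = (if i = j then 1 else 0)"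
    and ij: "i \<in> I" "j \<in> I"
  shows "A i j = C i j"
proof -
  have "A i j = (\<Sum>k\<in>I. A i k * (if k = j then 1 else 0))"
    using assms by (simp add: if_distrib cong: if_cong)
  also have "\<dots> = (\<Sum>k\<in>I. A i k * (\<Sum>l\<in>I. B k l * C l j))"
    using ij by (simp add: BC cong: sum.cong)
  also have "\<dots> = (\<Sum>l\<in>I. (\<Sum>k\<in>I. A i k * B k l) * C l j)"
    unfolding sum_distrib_left sum_distrib_right by (subst sum.swap) (simp add: mult.assoc)
  also have "\<dots> = (\<Sum>l\<in>I. (if i = l then 1 else 0) * C l j)"
    using ij by (simp add: AB cong: sum.cong)
  also have "\<dots> = C i j" using assms by (simp add: if_distrib[of "\<lambda>x. x * _"] cong: if_cong)
  finally show ?thesis .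
qed

text \<open>Since \<open>F = G * G\<close> with \<open>G\<close> hermitian is positive, \<open>F\<close> cannot have the eigenvalue \<open>- 1\<close>:
  for \<open>W = F - 1\<close> the equation \<open>F W = - W\<close>, which is
  \<open>F\<^sup>2 = 1\<close>, gives \<open>\<parallel>W\<parallel>\<^sup>2 = - \<parallel>G W\<parallel>\<^sup>2\<close> in the
  Hilbert-Schmidt norm.\<close>

lemma hermitian_square_involution:
  fixes F G :: "nat \<Rightarrow> nat \<Rightarrow> complex"
  assumes G: "\<And>i j. i < n \<Longrightarrow> j < n \<Longrightarrow> G j i = cnj (G i j)"
    and F: "\<And>i j. i < n \<Longrightarrow> j < n \<Longrightarrow> F i j = (\<Sum>k<n. G i k * G k j)"
    and FF: "\<And>i j. i < n \<Longrightarrow> j < n \<Longrightarrow> (\<Sum>k<n. F i k * F k j) = (if i = j then 1 else 0)"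
    and ij: "i < n" "j < n"
  shows "F i j = (if i = j then 1 else 0)"
proof -
  define W where "W i j = F i j - (if i = j then 1 else 0)" for i j
  define X where "X i j = (\<Sum>k<n. G i k * W k j)" for i j
  have FW: "(\<Sum>k<n. F i k * W k j) = - W i j" if "i < n" "j < n" for i j
    using that
    by (simp add: W_def right_diff_distrib sum_subtractf FF if_distrib[of "\<lambda>x. _ * x"] cong: if_cong)
  have GX: "(\<Sum>l<n. G i l * X l j) = - W i j" if "i < n" "j < n" for i j
  proof -
    have "(\<Sum>l<n. G i l * X l j) = (\<Sum>k<n. (\<Sum>l<n. G i l * G l k) * W k j)"
      unfolding X_def sum_distrib_left sum_distrib_right by (subst sum.swap) (simp add: mult.assoc)
    also have "\<dots> = (\<Sum>k<n. F i k * W k j)" using that by (simp add: F)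
    finally show ?thesis using FW that by simp
  qed
  have "(\<Sum>i<n. \<Sum>j<n. cnj (W i j) * W i j) = - (\<Sum>i<n. \<Sum>j<n. cnj (W i j) * (\<Sum>l<n. G i l * X l j))"
    by (simp add: GX sum_negf)
  also have "(\<Sum>i<n. \<Sum>j<n. cnj (W i j) * (\<Sum>l<n. G i l * X l j))
      = (\<Sum>j<n. \<Sum>i<n. \<Sum>l<n. cnj (G l i * W i j) * X l j)"
    unfolding sum_distrib_left
    by (rule HOL.trans[OF sum.swap]) (simp add: mult_ac flip: G)
  also have "\<dots> = (\<Sum>j<n. \<Sum>l<n. cnj (X l j) * X l j)"
    unfolding X_def cnj_sum sum_distrib_right by (rule sum.cong[OF HOL.refl], rule sum.swap)
  finally have "(\<Sum>i<n. \<Sum>j<n. cnj (W i j) * W i j) = - (\<Sum>j<n. \<Sum>l<n. cnj (X l j) * X l j)" .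
  then have "complex_of_real (\<Sum>i<n. \<Sum>j<n. (cmod (W i j))\<^sup>2)
      = complex_of_real (- (\<Sum>j<n. \<Sum>l<n. (cmod (X l j))\<^sup>2))"
    by (simp add: complex_norm_square mult.commute del: of_real_power)
  then have "(\<Sum>i<n. \<Sum>j<n. (cmod (W i j))\<^sup>2) = - (\<Sum>j<n. \<Sum>l<n. (cmod (X l j))\<^sup>2)"
    by (simp only: of_real_eq_iff)
  moreover have "(\<Sum>j<n. \<Sum>l<n. (cmod (X l j))\<^sup>2) \<ge> 0" by (simp add: sum_nonneg)
  moreover have "(cmod (W i j))\<^sup>2 \<le> (\<Sum>j<n. (cmod (W i j))\<^sup>2)"
    using ij by (intro member_le_sum) auto
  moreover have "(\<Sum>j<n. (cmod (W i j))\<^sup>2) \<le> (\<Sum>i<n. \<Sum>j<n. (cmod (W i j))\<^sup>2)"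
    using ij by (intro member_le_sum) (auto simp: sum_nonneg)
  ultimately have "(cmod (W i j))\<^sup>2 \<le> 0" by linarith
  then show ?thesis by (simp add: W_def)
qed

section \<open>The antipode on coefficients\<close>

text \<open>What the theorem uses of a compact quantum group: its Hopf *-algebra is spanned by the
  coefficients of unitary corepresentations, and \<open>\<eta>\<close> is an invariant state on it.\<close>

locale pol_algebra =
  fixes \<delta> :: "'a::star_algebra \<Rightarrow> 'a \<otimes> 'a"
    and \<epsilon> :: "'a \<Rightarrow> complex"
    and S :: "'a \<Rightarrow> 'a"
    and \<eta> :: "'a \<Rightarrow> complex"
    and f :: "complex \<Rightarrow> 'a \<Rightarrow> complex"
  assumes hopf: "hopf_star_algebra \<delta> \<epsilon> S"
    and characters: "woronowicz_characters \<delta> \<epsilon> S \<eta> f"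
    and positive: "positive_functional \<eta>"
    and unital: "\<eta> 1 = 1"
    and invariant: "slice_fst \<eta> (\<delta> a) = \<eta> a *\<^sub>C 1"
    and coefficients_span:
      "complex_vs.span {v i j |n v i j. unitary_corep_matrix \<delta> n v \<and> i < n \<and> j < n} = UNIV"
begin

lemma comult_clinear: "clinear \<delta>" and comult_mult: "\<delta> (a * b) = \<delta> a * \<delta> b"
  and comult_one: "\<delta> 1 = 1" and comult_star: "\<delta> (a\<^sup>\<star>) = (\<delta> a)\<^sup>\<star>"
  and counit_clinear: "clinear \<epsilon>" and counit_mult: "\<epsilon> (a * b) = \<epsilon> a * \<epsilon> b" and counit_one: "\<epsilon> 1 = 1"
  and antipode_clinear: "clinear S"
  using hopf by (auto simp: hopf_star_algebra_def star_hom_def alg_hom_def)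

lemma counit_left: "slice_fst \<epsilon> (\<delta> a) = a"
  using hopf by (auto simp: hopf_star_algebra_def)

lemma antipode_left: "tensor_lift (\<lambda>x y. S x * y) (\<delta> a) = \<epsilon> a *\<^sub>C 1"
  and antipode_right: "tensor_lift (\<lambda>x y. x * S y) (\<delta> a) = \<epsilon> a *\<^sub>C 1"
  using hopf by (auto simp: hopf_star_algebra_def)

lemma state_clinear: "clinear \<eta>"
  using positive by (simp add: positive_functional_def)

lemma character_clinear: "clinear (f z)" and character_mult: "f z (a * b) = f z a * f z b"
  using characters by (auto simp: woronowicz_characters_def alg_hom_def)

lemma character_conv: "conv \<delta> (f z) (f w) a = f (z + w) a"
  and character_antipode: "f z (S a) = f (- z) a"
  and character_star: "f (cnj z) (a\<^sup>\<star>) = cnj (f (- z) a)"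
  and character_zero: "f 0 = \<epsilon>"
  and antipode_antipode: "S (S a) = rconv \<delta> (lconv \<delta> (f (- 1)) a) (f 1)"
  and modular: "\<eta> (a * b) = \<eta> (b * rconv \<delta> (lconv \<delta> (f 1) a) (f 1))"
  using characters by (auto simp: woronowicz_characters_def)

text \<open>The principle by which all identities below are reduced to coefficients.\<close>

lemma clinear_eqI:
  assumes "clinear g" "clinear k"
    and "\<And>n v i j. unitary_corep_matrix \<delta> n v \<Longrightarrow> i < n \<Longrightarrow> j < n \<Longrightarrow> g (v i j) = k (v i j)"
  shows "g a = k a"
proof (rule clin.linear_eq_on[OF assms(1,2)])
  show "a \<in> complex_vs.span {v i j |n v i j. unitary_corep_matrix \<delta> n v \<and> i < n \<and> j < n}"
    by (simp add: coefficients_span)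
qed (use assms(3) in auto)

lemma comult_coefficient:
  "corep_matrix \<delta> I v \<Longrightarrow> i \<in> I \<Longrightarrow> j \<in> I \<Longrightarrow> \<delta> (v i j) = (\<Sum>k\<in>I. v i k \<otimes> v k j)"
  by (simp add: corep_matrix_def)

lemma unitary_corep_matrixD:
  assumes "unitary_corep_matrix \<delta> n v"
  shows "corep_matrix \<delta> {..<n} v"
    and "i < n \<Longrightarrow> j < n \<Longrightarrow> (\<Sum>k<n. v i k * (v j k)\<^sup>\<star>) = (if i = j then 1 else 0)"
    and "i < n \<Longrightarrow> j < n \<Longrightarrow> (\<Sum>k<n. (v k i)\<^sup>\<star> * v k j) = (if i = j then 1 else 0)"
  using assms by (auto simp: unitary_corep_matrix_def)

lemma corep_matrix_star:
  assumes "corep_matrix \<delta> I v"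
  shows "corep_matrix \<delta> I (\<lambda>i j. (v i j)\<^sup>\<star>)"
  using assms by (simp add: corep_matrix_def comult_star star_sum tensor_star_pure)

lemma corep_matrix_times:
  assumes "corep_matrix \<delta> I u" "corep_matrix \<delta> J w"
  shows "corep_matrix \<delta> (I \<times> J) (\<lambda>p q. u (fst p) (fst q) * w (snd p) (snd q))"
  using assms
  by (auto simp: corep_matrix_def comult_mult sum_product tensor_mult_pure sum.cartesian_product
      intro!: sum.cong)

lemma lconv_coefficient:
  assumes "corep_matrix \<delta> I v" "i \<in> I" "j \<in> I" "clinear \<phi>"
  shows "lconv \<delta> \<phi> (v i j) = (\<Sum>k\<in>I. \<phi> (v k j) *\<^sub>C v i k)"
  using assms
  by (simp add: lconv_def comult_coefficient clinear_sum[OF clinear_slice_snd] slice_snd_pure)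

lemma rconv_coefficient:
  assumes "corep_matrix \<delta> I v" "i \<in> I" "j \<in> I" "clinear \<phi>"
  shows "rconv \<delta> (v i j) \<phi> = (\<Sum>k\<in>I. \<phi> (v i k) *\<^sub>C v k j)"
  using assms
  by (simp add: rconv_def comult_coefficient clinear_sum[OF clinear_slice_fst] slice_fst_pure)

lemma lconv_clinear: "clinear \<phi> \<Longrightarrow> clinear (lconv \<delta> \<phi>)"
  unfolding lconv_def using clinear_comp[OF comult_clinear clinear_slice_snd] by (simp add: comp_def)

lemma rconv_clinear: "clinear \<phi> \<Longrightarrow> clinear (\<lambda>a. rconv \<delta> a \<phi>)"
  unfolding rconv_def using clinear_comp[OF comult_clinear clinear_slice_fst] by (simp add: comp_def)

lemma lconv_mult:
  assumes "clinear \<phi>" "\<And>a b. \<phi> (a * b) = \<phi> a * \<phi> b"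
  shows "lconv \<delta> \<phi> (a * b) = lconv \<delta> \<phi> a * lconv \<delta> \<phi> b"
proof -
  note sl = clinear_slice_snd[OF assms(1)]
  have "slice_snd \<phi> (s * t) = slice_snd \<phi> s * (slice_snd \<phi> t :: 'a)" for s t
  proof -
    obtain n x y where s: "s = (\<Sum>i<n::nat. x i \<otimes> y i)" using tensor_eq_sum_pure by blast
    obtain m x' y' where t: "t = (\<Sum>i<m::nat. x' i \<otimes> y' i)" using tensor_eq_sum_pure by blast
    show ?thesis
      by (simp add: s t sum_product tensor_mult_pure clinear_sum[OF sl] slice_snd_pure[OF assms(1)]
          assms(2) mult_scaleC_left mult_scaleC_right scaleC_scaleC mult.commute)
  qed
  then show ?thesis by (simp add: lconv_def comult_mult)
qed

lemma character_add_coefficient: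
  assumes "corep_matrix \<delta> I v" "i \<in> I" "j \<in> I"
  shows "f (z + w) (v i j) = (\<Sum>k\<in>I. f z (v i k) * f w (v k j))"
proof -
  have "balanced (\<lambda>x y. f z x * f w y)"
    by (rule balancedI)
       (simp_all add: clinear_add[OF character_clinear] clinear_functional_scale[OF character_clinear] algebra_simps)
  then show ?thesis
    using assms by (simp add: conv_def tensor_lift_sum_pure comult_coefficient flip: character_conv)
qed

lemma balanced_antipode_left: "balanced (\<lambda>x y. S x * y)"
  and balanced_antipode_right: "balanced (\<lambda>x y. x * S y)"
  by (rule balancedI; simp add: clinear_add[OF antipode_clinear] clinear_scale[OF antipode_clinear]
        distrib_left distrib_right mult_scaleC_left mult_scaleC_right)+

lemma antipode_left_coefficient:
  assumes "corep_matrix \<delta> I v" "i \<in> I" "j \<in> I"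
  shows "(\<Sum>k\<in>I. S (v i k) * v k j) = \<epsilon> (v i j) *\<^sub>C 1"
  using antipode_left[of "v i j"] assms
  by (simp add: comult_coefficient tensor_lift_sum_pure[OF balanced_antipode_left])

lemma antipode_right_coefficient:
  assumes "corep_matrix \<delta> I v" "i \<in> I" "j \<in> I"
  shows "(\<Sum>k\<in>I. v i k * S (v k j)) = \<epsilon> (v i j) *\<^sub>C 1"
  using antipode_right[of "v i j"] assms
  by (simp add: comult_coefficient tensor_lift_sum_pure[OF balanced_antipode_right])

text \<open>The counit law says that the scalar matrix \<open>\<epsilon>(v)\<close> satisfies \<open>\<epsilon>(v) v = v\<close>, and \<open>v\<close> is
  invertible.\<close>

lemma counit_coefficient:
  assumes "unitary_corep_matrix \<delta> n v" "i < n" "j < n"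
  shows "\<epsilon> (v i j) = (if i = j then 1 else 0)"
proof -
  note v = unitary_corep_matrixD[OF assms(1)]
  have row: "(\<Sum>k<n. \<epsilon> (v i k) *\<^sub>C v k l) = v i l" if "l < n" for l
    using rconv_coefficient[OF v(1) _ _ counit_clinear, of i l] that assms counit_left
    by (simp add: rconv_def)
  have "(\<Sum>l<n. (\<Sum>k<n. \<epsilon> (v i k) *\<^sub>C v k l) * (v j l)\<^sup>\<star>)
      = (\<Sum>k<n. \<epsilon> (v i k) *\<^sub>C (\<Sum>l<n. v k l * (v j l)\<^sup>\<star>))"
    unfolding sum_distrib_right scaleC_sum_right by (subst sum.swap) (simp add: mult_scaleC_left)
  also have "\<dots> = \<epsilon> (v i j) *\<^sub>C 1"
    using assms by (simp add: v if_distrib cong: if_cong)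
  finally have "\<epsilon> (\<epsilon> (v i j) *\<^sub>C 1) = \<epsilon> (if i = j then 1 else 0)"
    using assms by (simp add: row v)
  then show ?thesis
    by (simp add: clinear_functional_scale[OF counit_clinear] counit_one clinear_zero[OF counit_clinear] split: if_splits)
qed

text \<open>By the antipode law \<open>S(v)\<close> is a left inverse of \<open>v\<close>, and by unitarity the adjoint matrix is a
  right inverse.\<close>

lemma antipode_coefficient:
  assumes "unitary_corep_matrix \<delta> n v" "i < n" "j < n"
  shows "S (v i j) = (v j i)\<^sup>\<star>"
proof -
  note v = unitary_corep_matrixD[OF assms(1)]
  show ?thesis
  proof (rule matrix_left_inverse_eq_right_inverse[where I = "{..<n}" and A = "\<lambda>i j. S (v i j)"
        and B = v and C = "\<lambda>i j. (v j i)\<^sup>\<star>"])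
    fix i j assume "i \<in> {..<n}" "j \<in> {..<n}"
    then show "(\<Sum>k<n. S (v i k) * v k j) = (if i = j then 1 else 0)"
      using antipode_left_coefficient[OF v(1)] counit_coefficient[OF assms(1)]
      by (simp add: scaleC_one)
  qed (use assms v in auto)
qed

lemma comult_antipode_coefficient:
  assumes "unitary_corep_matrix \<delta> n v" "i < n" "j < n"
  shows "\<delta> (S (v i j)) = (\<Sum>k<n. S (v k j) \<otimes> S (v i k))"
  using assms comult_coefficient[OF corep_matrix_star[OF unitary_corep_matrixD(1)[OF assms(1)]], of j i]
  by (simp add: antipode_coefficient)

text \<open>Both sides, as matrices over pairs of indices, are inverse to the matrix with the entries
  \<open>u i j * w k l\<close>.\<close>

lemma antipode_mult_coefficients:
  assumes u: "unitary_corep_matrix \<delta> n u" "i < n" "j < n"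
    and w: "unitary_corep_matrix \<delta> m w" "k < m" "l < m"
  shows "S (u i j * w k l) = S (w k l) * S (u i j)"
proof -
  let ?I = "{..<n} \<times> {..<m}"
  let ?B = "\<lambda>p q. u (fst p) (fst q) * w (snd p) (snd q)"
  let ?C = "\<lambda>p q. S (w (snd p) (snd q)) * S (u (fst p) (fst q))"
  note cu = unitary_corep_matrixD(1)[OF u(1)] and cw = unitary_corep_matrixD(1)[OF w(1)]
  have counit: "\<epsilon> (?B p q) = (if p = q then 1 else 0)" if "p \<in> ?I" "q \<in> ?I" for p q
    using that by (auto simp: counit_mult counit_coefficient[OF u(1)] counit_coefficient[OF w(1)] prod_eq_iff)
  have "S (?B (i, k) (j, l)) = ?C (i, k) (j, l)"
  proof (rule matrix_left_inverse_eq_right_inverse[where I = ?I and B = ?B and A = "\<lambda>p q. S (?B p q)" and C = ?C])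
    fix p q assume pq: "p \<in> ?I" "q \<in> ?I"
    show "(\<Sum>r\<in>?I. S (?B p r) * ?B r q) = (if p = q then 1 else 0)"
      using antipode_left_coefficient[OF corep_matrix_times[OF cu cw] pq] counit[OF pq]
      by (simp add: scaleC_one)
    have "(\<Sum>r\<in>?I. ?B p r * ?C r q)
        = (\<Sum>a<n. \<Sum>b<m. u (fst p) a * (w (snd p) b * S (w b (snd q))) * S (u a (fst q)))"
      by (simp add: sum.cartesian_product case_prod_unfold mult.assoc)
    also have "\<dots> = (\<Sum>a<n. u (fst p) a * (\<Sum>b<m. w (snd p) b * S (w b (snd q))) * S (u a (fst q)))"
      by (simp add: sum_distrib_left sum_distrib_right)
    also have "\<dots> = (if p = q then 1 else 0)"
      using pq antipode_right_coefficient[OF cw, of "snd p" "snd q"]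
        antipode_right_coefficient[OF cu, of "fst p" "fst q"]
      by (auto simp: counit_coefficient[OF u(1)] counit_coefficient[OF w(1)] scaleC_one prod_eq_iff)
    finally show "(\<Sum>r\<in>?I. ?B p r * ?C r q) = (if p = q then 1 else 0)" .
  qed (use assms in auto)
  then show ?thesis by simp
qed

lemma clinear_mult_left: "clinear g \<Longrightarrow> clinear (\<lambda>x. c * (g x :: 'a))"
  and clinear_mult_right: "clinear g \<Longrightarrow> clinear (\<lambda>x. (g x :: 'a) * c)"
  for g :: "'b::complex_vs \<Rightarrow> 'a" and c :: 'a
  by (rule clinearI; simp add: clinear_add clinear_scale distrib_left distrib_right mult_scaleC_left mult_scaleC_right)+

lemma antipode_mult: "S (a * b) = S b * S a"
proof (rule clinear_eqI[of "\<lambda>a. S (a * b)" "\<lambda>a. S b * S a"])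
  note lin = antipode_clinear clinear_mult_left clinear_mult_right
    clinear_comp[OF clinear_mult_left[OF clinear_id] antipode_clinear, unfolded comp_def id_apply]
    clinear_comp[OF clinear_mult_right[OF clinear_id] antipode_clinear, unfolded comp_def id_apply]
  show "clinear (\<lambda>a. S (a * b))" "clinear (\<lambda>a. S b * S a)" by (intro lin)+
  fix n v i j assume v: "unitary_corep_matrix \<delta> n v" "i < n" "j < n"
  show "S (v i j * b) = S b * S (v i j)"
    by (rule clinear_eqI[of "\<lambda>b. S (v i j * b)" "\<lambda>b. S b * S (v i j)"])
       (intro lin, intro lin, rule antipode_mult_coefficients[OF v])
qed

lemma antipode_one: "S 1 = 1"
proof -
  have "\<delta> 1 = 1 \<otimes> 1" by (simp add: comult_one one_tensor_def)
  then show ?thesis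
    using antipode_left[of 1]
    by (simp add: tensor_lift_pure[OF balanced_antipode_left] counit_one scaleC_one)
qed

section \<open>The twisted adjoint action\<close>

abbreviation tS :: "'a \<Rightarrow> 'a" where "tS \<equiv> twisted_antipode \<delta> S f"
abbreviation tad :: "'a \<Rightarrow> 'a \<otimes> 'a" where "tad \<equiv> twisted_ad \<delta> S f"
abbreviation tad_h :: "'a \<Rightarrow> 'a" where "tad_h \<equiv> twisted_ad_h \<delta> S f \<eta>"

lemma twisted_antipode_clinear: "clinear tS"
  using clinear_comp[OF antipode_clinear lconv_clinear[OF character_clinear]]
  by (simp add: twisted_antipode_def[abs_def] comp_def)

lemma twisted_antipode_mult: "tS (a * b) = tS b * tS a"
  by (simp add: twisted_antipode_def antipode_mult lconv_mult character_clinear character_mult)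

lemma twisted_antipode_coefficient:
  assumes "unitary_corep_matrix \<delta> n v" "i < n" "j < n"
  shows "tS (v i j) = (\<Sum>k<n. f (- 1) (v i k) *\<^sub>C S (v k j))"
  using assms
  by (simp add: twisted_antipode_def lconv_def comult_antipode_coefficient
      clinear_sum[OF clinear_slice_snd] slice_snd_pure character_clinear character_antipode)

lemma twisted_antipode_eq: "tS a = tensor_lift (\<lambda>x y. f (- 1) x *\<^sub>C S y) (\<delta> a)"
proof (rule clinear_eqI[OF twisted_antipode_clinear])
  have bal: "balanced (\<lambda>x y. f (- 1) x *\<^sub>C S y)"
    by (rule balancedI)
       (simp_all add: clinear_add[OF character_clinear] clinear_functional_scale[OF character_clinear]
        clinear_add[OF antipode_clinear] clinear_scale[OF antipode_clinear]
        scaleC_add_left scaleC_add_right scaleC_scaleC mult.commute)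
  have "clinear (tensor_lift (\<lambda>x y. f (- 1) x *\<^sub>C S y))"
    by (rule clinear_tensor_lift[OF bal])
       (simp add: clinear_functional_scale[OF character_clinear] scaleC_scaleC)
  from clinear_comp[OF comult_clinear this]
  show "clinear (\<lambda>a. tensor_lift (\<lambda>x y. f (- 1) x *\<^sub>C S y) (\<delta> a))" by (simp add: comp_def)
  fix n v i j assume v: "unitary_corep_matrix \<delta> n v" "i < n" "j < n"
  then show "tS (v i j) = tensor_lift (\<lambda>x y. f (- 1) x *\<^sub>C S y) (\<delta> (v i j))"
    by (simp add: twisted_antipode_coefficient comult_coefficient[OF unitary_corep_matrixD(1)]
        tensor_lift_sum_pure[OF bal])
qed

text \<open>The behaviour of the characters under the antipode and under the involution combines to this,
  because \<open>S (v j i) = (v i j)\<^sup>\<star>\<close>. For real \<open>z\<close> the matrix \<open>f\<^sub>z(v)\<close> is thus hermitian.\<close>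

lemma character_coefficient_hermitian:
  assumes "unitary_corep_matrix \<delta> n v" "i < n" "j < n"
  shows "cnj (f z (v i j)) = f (cnj z) (v j i)"
proof -
  have "f (cnj z) (v j i) = f (cnj (- z)) (S (v j i))" by (simp add: character_antipode)
  also have "\<dots> = cnj (f z (v i j))"
    using assms character_star[of "- z" "v i j"] by (simp add: antipode_coefficient)
  finally show ?thesis by simp
qed

text \<open>This is \<open>f\<^sub>z \<star> (f\<^sub>-\<^sub>z \<star> a) = a\<close>, with the inner convolution expanded on a
  coefficient.\<close>

lemma lconv_cancel_coefficient:
  assumes v: "unitary_corep_matrix \<delta> n v" "i < n" "j < n"
  shows "(\<Sum>l<n. f (- z) (v l j) *\<^sub>C lconv \<delta> (f z) (v i l)) = v i j"
proof -
  note c = unitary_corep_matrixD(1)[OF v(1)]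
  have "(\<Sum>l<n. f (- z) (v l j) *\<^sub>C lconv \<delta> (f z) (v i l))
      = (\<Sum>k<n. (\<Sum>l<n. f z (v k l) * f (- z) (v l j)) *\<^sub>C v i k)"
    using v unfolding scaleC_sum_left
    by (subst sum.swap)
       (simp add: lconv_coefficient[OF c] character_clinear scaleC_sum_right scaleC_scaleC mult.commute)
  also have "\<dots> = (\<Sum>k<n. (if k = j then 1 else 0) *\<^sub>C v i k)"
    using v character_add_coefficient[OF c, of _ j z "- z"]
    by (simp add: character_zero counit_coefficient[OF v(1)])
  also have "\<dots> = v i j"
    using v by (simp add: if_distrib[of "\<lambda>c. c *\<^sub>C _"] scaleC_one cong: if_cong)
  finally show ?thesis .
qed

text \<open>With \<open>\<sigma>(a) = f\<^sub>1 \<star> a \<star> f\<^sub>1\<close> this is \<open>\<sigma>((tS c)\<^sup>\<star>) = tS (c\<^sup>\<star>)\<close>. On a coefficient both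
  sides are \<open>\<Sum>k. f\<^sub>1 (v j k) v k i\<close>: on the left, one factor \<open>f\<^sub>1\<close> of \<open>\<sigma>\<close> cancels the \<open>f\<^sub>-\<^sub>1\<close>
  in the twisted antipode; on the right, the \<open>f\<^sub>1\<close> in the twisted antipode cancels the \<open>f\<^sub>-\<^sub>1\<close> in
  \<open>S\<^sup>2\<close>. This is the identity for which the antipode is twisted.\<close>

lemma modular_star_twisted_antipode:
  "rconv \<delta> (lconv \<delta> (f 1) ((tS c)\<^sup>\<star>)) (f 1) = tS (c\<^sup>\<star>)"
proof -
  note lins = clinear_add[OF twisted_antipode_clinear] clinear_scale[OF twisted_antipode_clinear]
    clinear_add[OF lconv_clinear[OF character_clinear]] clinear_scale[OF lconv_clinear[OF character_clinear]]
    clinear_add[OF rconv_clinear[OF character_clinear]] clinear_scale[OF rconv_clinear[OF character_clinear]]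
    star_add star_scaleC
  \<comment> \<open>Both sides are antilinear in \<open>c\<close>; taking adjoints makes them linear.\<close>
  have "(rconv \<delta> (lconv \<delta> (f 1) ((tS c)\<^sup>\<star>)) (f 1))\<^sup>\<star> = (tS (c\<^sup>\<star>))\<^sup>\<star>"
  proof (rule clinear_eqI[of "\<lambda>c. (rconv \<delta> (lconv \<delta> (f 1) ((tS c)\<^sup>\<star>)) (f 1))\<^sup>\<star>" "\<lambda>c. (tS (c\<^sup>\<star>))\<^sup>\<star>"])
    show "clinear (\<lambda>c. (rconv \<delta> (lconv \<delta> (f 1) ((tS c)\<^sup>\<star>)) (f 1))\<^sup>\<star>)" "clinear (\<lambda>c. (tS (c\<^sup>\<star>))\<^sup>\<star>)"
      by (rule clinearI; simp add: lins)+
  next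
    fix n v i j assume v: "unitary_corep_matrix \<delta> n v" "i < n" "j < n"
    note c = unitary_corep_matrixD(1)[OF v(1)]
    note l = lconv_clinear[OF character_clinear]
    have star: "(tS (v i j))\<^sup>\<star> = (\<Sum>k<n. f (- 1) (v k i) *\<^sub>C v j k)"
      using v
      by (simp add: character_coefficient_hermitian[OF v(1)] twisted_antipode_coefficient star_sum star_scaleC antipode_coefficient star_star)
    have "rconv \<delta> (lconv \<delta> (f 1) ((tS (v i j))\<^sup>\<star>)) (f 1) = rconv \<delta> (v j i) (f 1)"
      using lconv_cancel_coefficient[OF v(1) v(3) v(2), of 1]
      by (simp add: star clinear_sum[OF l] clinear_scale[OF l])
    also have "\<dots> = (\<Sum>k<n. f 1 (v j k) *\<^sub>C v k i)"
      using v by (simp add: rconv_coefficient[OF c] character_clinear)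
    also have "\<dots> = (\<Sum>k<n. f 1 (v j k) *\<^sub>C lconv \<delta> (f 1) (\<Sum>m<n. f (- 1) (v m i) *\<^sub>C v k m))"
      using v lconv_cancel_coefficient[OF v(1) _ v(2), of _ 1]
      by (simp add: clinear_sum[OF l] clinear_scale[OF l])
    also have "\<dots> = lconv \<delta> (f 1) (\<Sum>m<n. f (- 1) (v m i) *\<^sub>C (\<Sum>k<n. f 1 (v j k) *\<^sub>C v k m))"
      unfolding scaleC_sum_right clinear_sum[OF l] clinear_scale[OF l]
      by (subst sum.swap) (simp add: scaleC_scaleC mult.commute)
    also have "\<dots> = lconv \<delta> (f 1) (S (S (v j i)))"
      using v by (simp add: antipode_antipode lconv_coefficient[OF c] rconv_coefficient[OF c]
          character_clinear clinear_sum[OF rconv_clinear[OF character_clinear]]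
          clinear_scale[OF rconv_clinear[OF character_clinear]])
    also have "\<dots> = tS ((v i j)\<^sup>\<star>)"
      using v by (simp add: twisted_antipode_def antipode_coefficient)
    finally show "(rconv \<delta> (lconv \<delta> (f 1) ((tS (v i j))\<^sup>\<star>)) (f 1))\<^sup>\<star> = (tS ((v i j)\<^sup>\<star>))\<^sup>\<star>"
      by simp
  qed
  then show ?thesis by (metis star_star)
qed

lemma state_twisted_antipode_star: "\<eta> (x * tS (c\<^sup>\<star>)) = \<eta> ((tS c)\<^sup>\<star> * x)"
  using modular[of "(tS c)\<^sup>\<star>" x] by (simp add: modular_star_twisted_antipode)

lemma balanced_twisted_ad:
  "balanced (\<lambda>x y. (x * tS z) \<otimes> (y :: 'a))"
  "balanced (\<lambda>t z. tensor_lift (\<lambda>x y. (x * tS z) \<otimes> (y :: 'a)) t)"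
proof -
  note lins = clinear_add[OF twisted_antipode_clinear] clinear_scale[OF twisted_antipode_clinear]
  show bal: "balanced (\<lambda>x y. (x * tS z) \<otimes> (y :: 'a))" for z
    by (rule balancedI)
       (simp_all add: pure_add_left pure_add_right distrib_right mult_scaleC_left pure_balanced)
  show "balanced (\<lambda>t z. tensor_lift (\<lambda>x y. (x * tS z) \<otimes> (y :: 'a)) t)"
    by (rule balanced_lift_nested[OF bal])
       (simp_all add: lins pure_add_left distrib_left mult_scaleC_left mult_scaleC_right)
qed

lemma twisted_ad_clinear: "clinear tad"
proof -
  have inner: "clinear (tensor_lift (\<lambda>x y. (x * tS z) \<otimes> (y :: 'a)))" for z
    by (rule clinear_tensor_lift[OF balanced_twisted_ad(1)]) (simp add: mult_scaleC_left scaleC_pure)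
  have "clinear (tensor_lift (\<lambda>t z. tensor_lift (\<lambda>x y. (x * tS z) \<otimes> (y :: 'a)) t))"
    by (rule clinear_tensor_lift[OF balanced_twisted_ad(2)]) (rule clinear_scale[OF inner])
  from clinear_comp[OF comult_clinear clinear_comp[OF clinear_tensor_map[OF comult_clinear clinear_id] this]]
  show ?thesis by (simp add: twisted_ad_def[abs_def] comp_def)
qed

lemma twisted_ad_h_clinear: "clinear tad_h"
  using clinear_comp[OF twisted_ad_clinear clinear_slice_fst[OF state_clinear]]
  by (simp add: twisted_ad_h_def[abs_def] comp_def)

lemma twisted_ad_coefficient:
  assumes "corep_matrix \<delta> I v" "i \<in> I" "j \<in> I"
  shows "tad (v i j) = (\<Sum>l\<in>I. \<Sum>k\<in>I. (v i k * tS (v l j)) \<otimes> v k l)"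
  using assms
  by (simp add: twisted_ad_def comult_coefficient clinear_sum[OF clinear_tensor_map[OF comult_clinear clinear_id]]
      tensor_map_pure[OF comult_clinear clinear_id] tensor_lift_sum_pure[OF balanced_twisted_ad(2)]
      tensor_lift_sum_pure[OF balanced_twisted_ad(1)] del: id_apply)
     (simp add: comult_coefficient tensor_lift_sum_pure[OF balanced_twisted_ad(1)])

lemma twisted_ad_h_coefficient:
  assumes "corep_matrix \<delta> I v" "i \<in> I" "j \<in> I"
  shows "tad_h (v i j) = (\<Sum>l\<in>I. \<Sum>k\<in>I. \<eta> (v i k * tS (v l j)) *\<^sub>C v k l)"
  by (simp add: twisted_ad_h_def twisted_ad_coefficient[OF assms]
      clinear_sum[OF clinear_slice_fst[OF state_clinear]] slice_fst_pure[OF state_clinear])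

lemma twisted_ad_h_eq:
  "tad_h a = tensor_lift (\<lambda>t z. tensor_lift (\<lambda>x y. \<eta> (x * tS z) *\<^sub>C y) t) (tensor_map \<delta> id (\<delta> a))"
proof -
  note sl = clinear_add[OF clinear_slice_fst[OF state_clinear]]
  show ?thesis
    by (simp add: twisted_ad_h_def twisted_ad_def additive_tensor_lift[OF balanced_twisted_ad(2) sl]
        additive_tensor_lift[OF balanced_twisted_ad(1) sl] slice_fst_pure[OF state_clinear])
qed

text \<open>The entries \<open>(u i j)\<^sup>\<star> * w k l\<close> form a corepresentation matrix indexed by pairs. The twisted
  antipode splits into two factors, one of which moves to the front of \<open>\<eta>\<close> as an adjoint.\<close>

lemma twisted_ad_h_star_mult_coefficients:
  assumes u: "unitary_corep_matrix \<delta> n u" "i < n" "j < n"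
    and w: "unitary_corep_matrix \<delta> m w" "k < m" "l < m"
  shows "tad_h ((u i j)\<^sup>\<star> * w k l) = slice_fst \<eta> ((tad (u i j))\<^sup>\<star> * tad (w k l))"
proof -
  note cu = unitary_corep_matrixD(1)[OF u(1)] and cw = unitary_corep_matrixD(1)[OF w(1)]
  note sl = clinear_slice_fst[OF state_clinear]
  have "tad_h ((u i j)\<^sup>\<star> * w k l)
      = (\<Sum>(r, s)\<in>{..<n} \<times> {..<m}. \<Sum>(p, q)\<in>{..<n} \<times> {..<m}.
          \<eta> ((u i p)\<^sup>\<star> * w k q * tS ((u r j)\<^sup>\<star> * w s l)) *\<^sub>C ((u p r)\<^sup>\<star> * w q s))"
    using twisted_ad_h_coefficient[OF corep_matrix_times[OF corep_matrix_star[OF cu] cw], of "(i, k)" "(j, l)"] u w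
    by (simp add: case_prod_unfold)
  also have "\<dots> = (\<Sum>r<n. \<Sum>s<m. \<Sum>p<n. \<Sum>q<m.
      \<eta> ((tS (u r j))\<^sup>\<star> * (u i p)\<^sup>\<star> * (w k q * tS (w s l))) *\<^sub>C ((u p r)\<^sup>\<star> * w q s))"
    by (simp add: twisted_antipode_mult mult.assoc[symmetric] state_twisted_antipode_star
        flip: sum.cartesian_product)
  also have "\<dots> = (\<Sum>r<n. \<Sum>p<n. \<Sum>s<m. \<Sum>q<m.
      \<eta> ((tS (u r j))\<^sup>\<star> * (u i p)\<^sup>\<star> * (w k q * tS (w s l))) *\<^sub>C ((u p r)\<^sup>\<star> * w q s))"
    by (intro sum.cong HOL.refl sum.swap)
  also have "\<dots> = slice_fst \<eta> ((\<Sum>r<n. \<Sum>p<n. ((tS (u r j))\<^sup>\<star> * (u i p)\<^sup>\<star>) \<otimes> (u p r)\<^sup>\<star>)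
      * (\<Sum>s<m. \<Sum>q<m. (w k q * tS (w s l)) \<otimes> w q s))"
    unfolding sum_distrib_right
    unfolding sum_distrib_left clinear_sum[OF sl] tensor_mult_pure slice_fst_pure[OF state_clinear] ..
  also have "\<dots> = slice_fst \<eta> ((tad (u i j))\<^sup>\<star> * tad (w k l))"
    using u w by (simp add: twisted_ad_coefficient[OF cu] twisted_ad_coefficient[OF cw] star_sum
        tensor_star_pure star_mult)
  finally show ?thesis .
qed

lemma twisted_ad_h_star_mult: "tad_h (a\<^sup>\<star> * b) = slice_fst \<eta> ((tad a)\<^sup>\<star> * tad b)"
proof -
  note lins = clinear_add[OF twisted_ad_clinear] clinear_scale[OF twisted_ad_clinear]
    clinear_add[OF twisted_ad_h_clinear] clinear_scale[OF twisted_ad_h_clinear]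
    clinear_add[OF clinear_slice_fst[OF state_clinear]] clinear_scale[OF clinear_slice_fst[OF state_clinear]]
    star_add star_scaleC distrib_left distrib_right mult_scaleC_left mult_scaleC_right
  \<comment> \<open>Both sides are antilinear in \<open>a\<close>; taking adjoints makes them linear.\<close>
  have "(tad_h (a\<^sup>\<star> * b))\<^sup>\<star> = (slice_fst \<eta> ((tad a)\<^sup>\<star> * tad b))\<^sup>\<star>"
  proof (rule clinear_eqI[of "\<lambda>a. (tad_h (a\<^sup>\<star> * b))\<^sup>\<star>" "\<lambda>a. (slice_fst \<eta> ((tad a)\<^sup>\<star> * tad b))\<^sup>\<star>"])
    show "clinear (\<lambda>a. (tad_h (a\<^sup>\<star> * b))\<^sup>\<star>)" "clinear (\<lambda>a. (slice_fst \<eta> ((tad a)\<^sup>\<star> * tad b))\<^sup>\<star>)"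
      by (rule clinearI; simp add: lins)+
    fix n u i j assume u: "unitary_corep_matrix \<delta> n u" "i < n" "j < n"
    have "tad_h ((u i j)\<^sup>\<star> * b) = slice_fst \<eta> ((tad (u i j))\<^sup>\<star> * tad b)"
      by (rule clinear_eqI[of "\<lambda>b. tad_h ((u i j)\<^sup>\<star> * b)" "\<lambda>b. slice_fst \<eta> ((tad (u i j))\<^sup>\<star> * tad b)"])
         ((rule clinearI; simp add: lins), (rule clinearI; simp add: lins),
           rule twisted_ad_h_star_mult_coefficients[OF u])
    then show "(tad_h ((u i j)\<^sup>\<star> * b))\<^sup>\<star> = (slice_fst \<eta> ((tad (u i j))\<^sup>\<star> * tad b))\<^sup>\<star>" by simp
  qed
  then show ?thesis by (metis star_star)
qed

lemma twisted_ad_h_square: "\<exists>(m::nat) b. tad_h (a\<^sup>\<star> * a) = (\<Sum>i<m. (b i)\<^sup>\<star> * b i)"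
  unfolding twisted_ad_h_star_mult by (rule slice_fst_square[OF positive])

lemma positive_functional_twisted_ad_h:
  assumes "positive_functional \<omega>"
  shows "positive_functional (\<omega> \<circ> tad_h)"
  unfolding positive_functional_def
proof (intro conjI allI)
  have lin: "clinear \<omega>" and pos: "\<omega> (b\<^sup>\<star> * b) \<in> \<real>\<^sub>\<ge>\<^sub>0" for b
    using assms by (auto simp: positive_functional_def)
  show "clinear (\<omega> \<circ> tad_h)" by (rule clinear_comp[OF twisted_ad_h_clinear lin])
  fix a
  obtain m :: nat and b where b: "tad_h (a\<^sup>\<star> * a) = (\<Sum>i<m. (b i)\<^sup>\<star> * b i)"
    using twisted_ad_h_square by blast
  have "(\<Sum>i<m. \<omega> ((b i)\<^sup>\<star> * b i)) \<in> \<real>\<^sub>\<ge>\<^sub>0"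
    by (induction m) (simp_all add: pos nonneg_Reals_add_I)
  then show "(\<omega> \<circ> tad_h) (a\<^sup>\<star> * a) \<in> \<real>\<^sub>\<ge>\<^sub>0"
    by (simp add: b clinear_sum[OF lin])
qed

section \<open>Kac type\<close>

text \<open>The identity \<open>S(a\<^sub>2) a\<^sub>1 = \<epsilon>(a) 1\<close>: apply \<open>S\<close> to the antipode law and use \<open>S\<^sup>2 = id\<close>.\<close>

lemma kac_antipode_left:
  assumes "kac_type S" and v: "unitary_corep_matrix \<delta> n v" "i < n" "j < n"
  shows "(\<Sum>k<n. S (v k j) * v i k) = (if i = j then 1 else 0)"
proof -
  have SS: "S (S a) = a" for a using assms(1) by (metis comp_apply id_apply kac_type_def)
  have "(\<Sum>k<n. S (v k j) * v i k) = S (\<Sum>k<n. S (v i k) * v k j)"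
    by (simp add: clinear_sum[OF antipode_clinear] antipode_mult SS)
  also have "\<dots> = (if i = j then 1 else 0)"
    using v antipode_left_coefficient[OF unitary_corep_matrixD(1)[OF v(1)], of i j]
    by (simp add: counit_coefficient[OF v(1)] scaleC_one antipode_one clinear_zero[OF antipode_clinear])
  finally show ?thesis .
qed

text \<open>From \<open>S\<^sup>2 = id\<close> it follows that \<open>f\<^sub>1\<close> is central, that is, \<open>f\<^sub>1(v)\<close> commutes with \<open>v\<close>.\<close>

lemma kac_rconv_eq_lconv:
  assumes "kac_type S" and v: "unitary_corep_matrix \<delta> n v" "i < n" "j < n"
  shows "rconv \<delta> (v i j) (f 1) = lconv \<delta> (f 1) (v i j)"
proof -
  note c = unitary_corep_matrixD(1)[OF v(1)]
  note l = lconv_clinear[OF character_clinear] and r = rconv_clinear[OF character_clinear]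
  have SS: "rconv \<delta> (lconv \<delta> (f (- 1)) a) (f 1) = a" for a
    using assms(1) antipode_antipode by (metis comp_apply id_apply kac_type_def)
  have "lconv \<delta> (f 1) (v i j) = (\<Sum>k<n. f 1 (v k j) *\<^sub>C v i k)"
    using v by (simp add: lconv_coefficient[OF c] character_clinear)
  also have "\<dots> = (\<Sum>k<n. f 1 (v k j) *\<^sub>C rconv \<delta> (lconv \<delta> (f (- 1)) (v i k)) (f 1))"
    by (simp only: SS)
  also have "\<dots> = rconv \<delta> (\<Sum>k<n. f 1 (v k j) *\<^sub>C lconv \<delta> (f (- 1)) (v i k)) (f 1)"
    by (simp add: clinear_sum[OF r] clinear_scale[OF r])
  also have "\<dots> = rconv \<delta> (v i j) (f 1)"
    using lconv_cancel_coefficient[OF v, of "- 1"] by simp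
  finally show ?thesis by simp
qed

text \<open>For central \<open>f\<^sub>1\<close> the modular automorphism is \<open>\<sigma>(a) = f\<^sub>2(a\<^sub>1) a\<^sub>2\<close>. Hence
  \<open>\<epsilon>(a) = \<eta>(a\<^sub>1 S(a\<^sub>2)) = \<eta>(S(a\<^sub>2) \<sigma>(a\<^sub>1)) = f\<^sub>2(a\<^sub>1) \<eta>(S(a\<^sub>3) a\<^sub>2) = f\<^sub>2(a)\<close>,
  the last step by \<open>S(a\<^sub>2) a\<^sub>1 = \<epsilon>(a) 1\<close>.\<close>

lemma kac_character_two:
  assumes kac: "kac_type S" and v: "unitary_corep_matrix \<delta> n v" "i < n" "j < n"
  shows "f 2 (v i j) = (if i = j then 1 else 0)"
proof -
  note c = unitary_corep_matrixD(1)[OF v(1)]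
  note r = rconv_clinear[OF character_clinear]
  have \<sigma>: "rconv \<delta> (lconv \<delta> (f 1) (v i k)) (f 1) = (\<Sum>l<n. f 2 (v i l) *\<^sub>C v l k)" if "k < n" for k
  proof -
    have lc: "lconv \<delta> (f 1) (v i k) = (\<Sum>m<n. f 1 (v i m) *\<^sub>C v m k)"
      using that v by (simp add: rconv_coefficient[OF c] character_clinear
          flip: kac_rconv_eq_lconv[OF kac v(1)])
    have "rconv \<delta> (lconv \<delta> (f 1) (v i k)) (f 1)
        = (\<Sum>m<n. f 1 (v i m) *\<^sub>C (\<Sum>l<n. f 1 (v m l) *\<^sub>C v l k))"
      using that by (simp add: lc rconv_coefficient[OF c] character_clinear clinear_sum[OF r] clinear_scale[OF r])
    also have "\<dots> = (\<Sum>l<n. (\<Sum>m<n. f 1 (v i m) * f 1 (v m l)) *\<^sub>C v l k)"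
      unfolding scaleC_sum_right scaleC_sum_left by (subst sum.swap) (simp add: scaleC_scaleC)
    also have "\<dots> = (\<Sum>l<n. f 2 (v i l) *\<^sub>C v l k)"
      using v character_add_coefficient[OF c, of i _ 1 1] by simp
    finally show ?thesis .
  qed
  have "(if i = j then 1 else 0) = \<eta> (\<Sum>k<n. v i k * S (v k j))"
    using v by (simp add: antipode_right_coefficient[OF c] counit_coefficient[OF v(1)] scaleC_one
        unital clinear_zero[OF state_clinear])
  also have "\<dots> = (\<Sum>k<n. \<eta> (S (v k j) * (\<Sum>l<n. f 2 (v i l) *\<^sub>C v l k)))"
    by (simp add: clinear_sum[OF state_clinear] modular[of "v i _"] \<sigma>)
  also have "\<dots> = \<eta> (\<Sum>l<n. f 2 (v i l) *\<^sub>C (\<Sum>k<n. S (v k j) * v l k))"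
    unfolding sum_distrib_left scaleC_sum_right clinear_sum[OF state_clinear, symmetric]
    by (subst sum.swap) (simp add: mult_scaleC_right)
  also have "\<dots> = (\<Sum>l<n. f 2 (v i l) * (if l = j then 1 else 0))"
    using v by (simp add: kac_antipode_left[OF kac] clinear_sum[OF state_clinear]
        clinear_functional_scale[OF state_clinear] unital clinear_zero[OF state_clinear]
        if_distrib[of \<eta>] cong: if_cong)
  also have "\<dots> = f 2 (v i j)" using v by (simp add: if_distrib cong: if_cong)
  finally show ?thesis by simp
qed

text \<open>\<open>f\<^sub>1(v)\<close> is the square of the hermitian matrix \<open>f\<^sub>1\<^sub>/\<^sub>2(v)\<close>, and its own square is \<open>f\<^sub>2(v) = 1\<close>.\<close>

lemma kac_character_one:
  assumes kac: "kac_type S"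
  shows "f 1 a = \<epsilon> a"
proof (rule clinear_eqI[OF character_clinear counit_clinear])
  fix n v i j assume v: "unitary_corep_matrix \<delta> n v" "i < n" "j < n"
  note c = unitary_corep_matrixD(1)[OF v(1)]
  have "f 1 (v i j) = (if i = j then 1 else 0)"
  proof (rule hermitian_square_involution[where G = "\<lambda>i j. f (1/2) (v i j)" and F = "\<lambda>i j. f 1 (v i j)"])
    fix i j assume ij: "i < n" "j < n"
    show "f (1/2) (v j i) = cnj (f (1/2) (v i j))"
      using character_coefficient_hermitian[OF v(1) ij, of "1/2"] by simp
    show "f 1 (v i j) = (\<Sum>k<n. f (1/2) (v i k) * f (1/2) (v k j))"
      using character_add_coefficient[OF c, of i j "1/2" "1/2"] ij by simp
    show "(\<Sum>k<n. f 1 (v i k) * f 1 (v k j)) = (if i = j then 1 else 0)"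
      using character_add_coefficient[OF c, of i j 1 1] ij kac_character_two[OF kac v(1)] by simp
  qed (use v in auto)
  then show "f 1 (v i j) = \<epsilon> (v i j)" using v by (simp add: counit_coefficient)
qed

lemma kac_twisted_antipode:
  assumes "kac_type S"
  shows "tS a = S a"
proof -
  have "f 1 = \<epsilon>" using kac_character_one[OF assms] by blast
  then show ?thesis
    using hopf by (simp add: twisted_antipode_def lconv_def hopf_star_algebra_def)
qed

text \<open>Invariance of \<open>\<eta>\<close> at \<open>v i p * S (v q j)\<close>, where the antipode reverses the legs. In
  Sweedler notation it yields \<open>\<eta>(a\<^sub>1 S(a\<^sub>5)) \<eta>(a\<^sub>2 S(a\<^sub>4)) a\<^sub>3 = \<eta>(a\<^sub>1 S(a\<^sub>3)) a\<^sub>2\<close>.\<close>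

lemma state_invariant_coefficients:
  assumes v: "unitary_corep_matrix \<delta> n v" and idx: "i < n" "j < n" "p < n" "q < n"
  shows "(\<Sum>l<n. \<Sum>k<n. \<eta> (v i k * S (v l j)) * \<eta> (v k p * S (v q l))) = \<eta> (v i p * S (v q j))"
proof -
  note c = unitary_corep_matrixD(1)[OF v]
  have "\<delta> (v i p * S (v q j)) = (\<Sum>l<n. \<Sum>k<n. (v i k * S (v l j)) \<otimes> (v k p * S (v q l)))"
    using idx by (subst sum.swap)
      (simp add: comult_mult comult_coefficient[OF c] comult_antipode_coefficient[OF v] sum_product
        tensor_mult_pure)
  then have "\<eta> (v i p * S (v q j)) *\<^sub>C 1
      = (\<Sum>l<n. \<Sum>k<n. \<eta> (v i k * S (v l j)) *\<^sub>C (v k p * S (v q l)))"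
    by (simp add: clinear_sum[OF clinear_slice_fst[OF state_clinear]] slice_fst_pure[OF state_clinear]
        flip: invariant)
  then have "\<eta> (\<eta> (v i p * S (v q j)) *\<^sub>C 1)
      = \<eta> (\<Sum>l<n. \<Sum>k<n. \<eta> (v i k * S (v l j)) *\<^sub>C (v k p * S (v q l)))"
    by simp
  then show ?thesis
    by (simp add: clinear_sum[OF state_clinear] clinear_functional_scale[OF state_clinear] unital)
qed

lemma kac_twisted_ad_h_idempotent:
  assumes kac: "kac_type S"
  shows "tad_h (tad_h a) = tad_h a"
proof (rule clinear_eqI[of "\<lambda>a. tad_h (tad_h a)" tad_h])
  show "clinear tad_h" by (rule twisted_ad_h_clinear)
  from clinear_comp[OF this this] show "clinear (\<lambda>a. tad_h (tad_h a))" by (simp add: comp_def)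
  fix n v i j assume v: "unitary_corep_matrix \<delta> n v" "i < n" "j < n"
  note c = unitary_corep_matrixD(1)[OF v(1)]
  have ad: "tad_h (v i j) = (\<Sum>q<n. \<Sum>p<n. \<eta> (v i p * S (v q j)) *\<^sub>C v p q)" if "i < n" "j < n" for i j
    using that by (simp add: twisted_ad_h_coefficient[OF c] kac_twisted_antipode[OF kac])
  have "tad_h (tad_h (v i j)) = (\<Sum>l<n. \<Sum>k<n. \<Sum>q<n. \<Sum>p<n.
      (\<eta> (v i k * S (v l j)) * \<eta> (v k p * S (v q l))) *\<^sub>C v p q)"
    using v by (simp add: ad clinear_sum[OF twisted_ad_h_clinear] clinear_scale[OF twisted_ad_h_clinear]
        scaleC_sum_right scaleC_scaleC)
  also have "\<dots> = (\<Sum>l<n. \<Sum>q<n. \<Sum>p<n. \<Sum>k<n.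
      (\<eta> (v i k * S (v l j)) * \<eta> (v k p * S (v q l))) *\<^sub>C v p q)"
    by (rule sum.cong[OF HOL.refl], rule HOL.trans[OF sum.swap], rule sum.cong[OF HOL.refl],
        rule sum.swap)
  also have "\<dots> = (\<Sum>q<n. \<Sum>p<n. \<Sum>l<n. \<Sum>k<n.
      (\<eta> (v i k * S (v l j)) * \<eta> (v k p * S (v q l))) *\<^sub>C v p q)"
    by (rule HOL.trans[OF sum.swap], rule sum.cong[OF HOL.refl], rule sum.swap)
  also have "\<dots> = tad_h (v i j)"
    using v unfolding scaleC_sum_left[symmetric]
    by (simp add: state_invariant_coefficients[OF v(1)] ad)
  finally show "tad_h (tad_h (v i j)) = tad_h (v i j)" .
qed

end

section \<open>Passage from the C*-algebra to its coefficients\<close>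

text \<open>The comultiplication of a coefficient is determined by its image in the completed tensor square,
  because both \<open>\<tau>\<close> and \<open>\<iota> \<otimes> \<iota>\<close> are injective.\<close>

lemma unitary_corep_matrix_pullback:
  assumes min: "min_tensor \<tau>"
    and pol: "pol_hopf_algebra \<tau> \<Delta> \<iota> \<delta> \<epsilon> S"
    and u: "unitary_corep \<tau> \<Delta> n u"
    and v: "\<And>i j. i < n \<Longrightarrow> j < n \<Longrightarrow> \<iota> (v i j) = u i j"
  shows "unitary_corep_matrix \<delta> n v"
proof -
  have \<tau>: "clinear \<tau>" "inj \<tau>"
    using min by (auto simp: min_tensor_def star_hom_def alg_hom_def)
  have \<iota>: "clinear \<iota>" "inj \<iota>" "\<iota> 1 = 1" "\<iota> (x * y) = \<iota> x * \<iota> y" "\<iota> (x\<^sup>\<star>) = (\<iota> x)\<^sup>\<star>" for x y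
    using pol by (auto simp: pol_hopf_algebra_def star_hom_def alg_hom_def)
  have comult: "\<tau> (tensor_map \<iota> \<iota> (\<delta> a)) = \<Delta> (\<iota> a)" for a
    using pol by (auto simp: pol_hopf_algebra_def)
  have "\<delta> (v i j) = (\<Sum>k<n. v i k \<otimes> v k j)" if "i < n" "j < n" for i j
  proof -
    have "\<tau> (tensor_map \<iota> \<iota> (\<delta> (v i j))) = \<tau> (tensor_map \<iota> \<iota> (\<Sum>k<n. v i k \<otimes> v k j))"
      using that u
      by (simp add: comult v unitary_corep_def clinear_sum[OF \<tau>(1)]
          clinear_sum[OF clinear_tensor_map[OF \<iota>(1) \<iota>(1)]] tensor_map_pure[OF \<iota>(1) \<iota>(1)])
    then show ?thesis
      by (simp only: inj_eq[OF \<tau>(2)] inj_eq[OF inj_tensor_map[OF \<iota>(1,2)]])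
  qed
  moreover have "(\<Sum>k<n. v i k * (v j k)\<^sup>\<star>) = (if i = j then 1 else 0)"
    and "(\<Sum>k<n. (v k i)\<^sup>\<star> * v k j) = (if i = j then 1 else 0)" if "i < n" "j < n" for i j
  proof -
    have "\<iota> (\<Sum>k<n. v i k * (v j k)\<^sup>\<star>) = \<iota> (if i = j then 1 else 0)"
      "\<iota> (\<Sum>k<n. (v k i)\<^sup>\<star> * v k j) = \<iota> (if i = j then 1 else 0)"
      using that u
      by (simp_all add: clinear_sum[OF \<iota>(1)] \<iota>(3-) v unitary_corep_def clinear_zero[OF \<iota>(1)])
    then show "(\<Sum>k<n. v i k * (v j k)\<^sup>\<star>) = (if i = j then 1 else 0)"
      "(\<Sum>k<n. (v k i)\<^sup>\<star> * v k j) = (if i = j then 1 else 0)"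
      by (simp_all only: inj_eq[OF \<iota>(2)])
  qed
  ultimately show ?thesis by (simp add: unitary_corep_matrix_def corep_matrix_def)
qed

lemma coefficients_span_pol:
  assumes min: "min_tensor \<tau>"
    and pol: "pol_hopf_algebra \<tau> \<Delta> \<iota> \<delta> \<epsilon> S"
  shows "complex_vs.span {v i j |n v i j. unitary_corep_matrix \<delta> n v \<and> i < n \<and> j < n} = UNIV"
    (is "complex_vs.span ?B = UNIV")
proof -
  have \<iota>: "clinear \<iota>" "inj \<iota>" "range \<iota> = Pol \<tau> \<Delta>"
    using pol by (auto simp: pol_hopf_algebra_def star_hom_def alg_hom_def)
  let ?U = "{u i j |n u i j. unitary_corep \<tau> \<Delta> n u \<and> i < n \<and> j < n}"
  have "?U \<subseteq> \<iota> ` ?B"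
  proof
    fix x assume "x \<in> ?U"
    then obtain n u i j where u: "x = u i j" "unitary_corep \<tau> \<Delta> n u" "i < n" "j < n" by blast
    have "u i j \<in> range \<iota>" if "i < n" "j < n" for i j
      unfolding \<iota>(3) Pol_def by (rule complex_vs.span_base) (use u that in blast)
    moreover define v where "v i j = inv \<iota> (u i j)" for i j
    ultimately have \<iota>v: "\<iota> (v i j) = u i j" if "i < n" "j < n" for i j
      using that by (simp add: f_inv_into_f)
    have "unitary_corep_matrix \<delta> n v"
      by (rule unitary_corep_matrix_pullback[OF min pol u(2)]) (rule \<iota>v)
    then have "v i j \<in> ?B" using u(3,4) by blast
    moreover have "x = \<iota> (v i j)" using \<iota>v u by simp
    ultimately show "x \<in> \<iota> ` ?B" by (rule rev_image_eqI)
  qed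
  then have "range \<iota> \<subseteq> \<iota> ` complex_vs.span ?B"
    unfolding \<iota>(3) Pol_def clin.linear_span_image[OF \<iota>(1), symmetric] by (rule complex_vs.span_mono)
  then show ?thesis using \<iota>(2) by (auto simp: inj_image_subset_iff)
qed

text \<open>On the image of the algebraic tensor square, the continuous extension of \<open>h \<otimes> id\<close> is the
  algebraic slice map.\<close>

lemma haar_state_pol_invariant:
  assumes min: "min_tensor \<tau>"
    and haar: "haar_state \<tau> \<Delta> h"
    and pol: "pol_hopf_algebra \<tau> \<Delta> \<iota> \<delta> \<epsilon> S"
  shows "slice_fst (h \<circ> \<iota>) (\<delta> a) = (h \<circ> \<iota>) a *\<^sub>C 1"
proof -
  have \<tau>: "clinear \<tau>" using min by (auto simp: min_tensor_def star_hom_def alg_hom_def)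
  have \<iota>: "clinear \<iota>" "inj \<iota>" "\<iota> 1 = 1"
    using pol by (auto simp: pol_hopf_algebra_def star_hom_def alg_hom_def)
  have comult: "\<tau> (tensor_map \<iota> \<iota> (\<delta> a)) = \<Delta> (\<iota> a)"
    using pol by (auto simp: pol_hopf_algebra_def)
  have h: "clinear h" using haar by (auto simp: haar_state_def state_def positive_functional_def)
  define \<eta> where "\<eta> = h \<circ> \<iota>"
  have hi: "clinear \<eta>" "\<eta> a = h (\<iota> a)" for a
    unfolding \<eta>_def by (rule clinear_comp[OF \<iota>(1) h]) simp
  obtain L where L: "tensor_extension \<tau> (\<lambda>a b. h a *\<^sub>C b) L" "\<And>a. L (\<Delta> a) = h a *\<^sub>C 1"
    using haar by (auto simp: haar_state_def)
  then have Lp: "L (\<tau> (\<iota> a \<otimes> b)) = \<eta> a *\<^sub>C b" and bl: "bounded_linear L" for a b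
    by (auto simp: tensor_extension_def hi(2))
  have Ladd: "L (x + y) = L x + L y" for x y
    by (rule linear_add[OF bounded_linear.linear[OF bl]])
  have L0: "L 0 = 0" using Ladd[of 0 0] by simp
  have "L (\<tau> (tensor_map \<iota> \<iota> t)) = \<iota> (slice_fst \<eta> t)" for t
  proof (induction t rule: tensor_induct)
    case zero
    show ?case
      by (simp add: clinear_zero[OF clinear_tensor_map] \<iota>(1) clinear_zero[OF \<tau>] L0
          clinear_zero[OF clinear_slice_fst[OF hi(1)]] clinear_zero[OF \<iota>(1)])
  next
    case (add a b t)
    then show ?case
      by (simp add: clinear_add[OF clinear_tensor_map] \<iota>(1) clinear_add[OF \<tau>] Ladd Lp
          clinear_add[OF clinear_slice_fst[OF hi(1)]] clinear_add[OF \<iota>(1)]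
          tensor_map_pure slice_fst_pure[OF hi(1)] clinear_scale[OF \<iota>(1)])
  qed
  then have "\<iota> (slice_fst \<eta> (\<delta> a)) = \<iota> (\<eta> a *\<^sub>C 1)"
    using L(2)[of "\<iota> a"] hi(2)[of a] by (simp add: clinear_scale[OF \<iota>(1)] \<iota>(3) flip: comult)
  then show ?thesis unfolding \<eta>_def by (rule injD[OF \<iota>(2)])
qed

lemma pol_algebra_of_compact_quantum_group:
  assumes "compact_quantum_group \<tau> \<theta>\<^sub>1 \<theta>\<^sub>2 \<Delta>"
    and haar: "haar_state \<tau> \<Delta> h"
    and pol: "pol_hopf_algebra \<tau> \<Delta> \<iota> \<delta> \<epsilon> S"
    and chars: "woronowicz_characters \<delta> \<epsilon> S (h \<circ> \<iota>) f"
  shows "pol_algebra \<delta> \<epsilon> S (h \<circ> \<iota>) f"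
proof -
  have min: "min_tensor \<tau>" using assms(1) by (simp add: compact_quantum_group_def)
  have \<iota>: "clinear \<iota>" "\<iota> 1 = 1" "\<iota> (x * y) = \<iota> x * \<iota> y" "\<iota> (x\<^sup>\<star>) = (\<iota> x)\<^sup>\<star>" for x y
    using pol by (auto simp: pol_hopf_algebra_def star_hom_def alg_hom_def)
  have h: "positive_functional h" "h 1 = 1" using haar by (auto simp: haar_state_def state_def)
  show ?thesis
  proof
    show "hopf_star_algebra \<delta> \<epsilon> S" using pol by (simp add: pol_hopf_algebra_def)
    show "woronowicz_characters \<delta> \<epsilon> S (h \<circ> \<iota>) f" by (rule chars)
    show "positive_functional (h \<circ> \<iota>)"
      using h(1) clinear_comp[OF \<iota>(1), of h] by (auto simp: positive_functional_def \<iota>)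
    show "(h \<circ> \<iota>) 1 = 1" by (simp add: \<iota> h)
    show "slice_fst (h \<circ> \<iota>) (\<delta> a) = (h \<circ> \<iota>) a *\<^sub>C 1" for a
      by (rule haar_state_pol_invariant[OF min haar pol])
    show "complex_vs.span {v i j |n v i j. unitary_corep_matrix \<delta> n v \<and> i < n \<and> j < n} = UNIV"
      by (rule coefficients_span_pol[OF min pol])
  qed
qed

section \<open>Positivity and idempotence for compact quantum groups\<close>

theorem theorem6p10:
  fixes \<tau> :: "'c::cstar_algebra \<otimes> 'c \<Rightarrow> 't::cstar_algebra"
    and \<theta>\<^sub>1 :: "'t \<otimes> 'c \<Rightarrow> 't3::cstar_algebra"
    and \<theta>\<^sub>2 :: "'c \<otimes> 't \<Rightarrow> 't3"
    and \<Delta> :: "'c \<Rightarrow> 't"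
    and h :: "'c \<Rightarrow> complex"
    and \<iota> :: "'a::star_algebra \<Rightarrow> 'c"
    and \<delta> :: "'a \<Rightarrow> 'a \<otimes> 'a"
    and \<epsilon> :: "'a \<Rightarrow> complex"
    and S :: "'a \<Rightarrow> 'a"
    and f :: "complex \<Rightarrow> 'a \<Rightarrow> complex"
  assumes "compact_quantum_group \<tau> \<theta>\<^sub>1 \<theta>\<^sub>2 \<Delta>"
    and "haar_state \<tau> \<Delta> h"
    and "pol_hopf_algebra \<tau> \<Delta> \<iota> \<delta> \<epsilon> S"
    and "woronowicz_characters \<delta> \<epsilon> S (h \<circ> \<iota>) f"
  shows "(\<forall>a. twisted_antipode \<delta> S f a = tensor_lift (\<lambda>x y. f (- 1) x *\<^sub>C S y) (\<delta> a)) \<and>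
    (\<forall>a. twisted_ad_h \<delta> S f (h \<circ> \<iota>) a =
         tensor_lift (\<lambda>t z. tensor_lift (\<lambda>x y. h (\<iota> (x * twisted_antipode \<delta> S f z)) *\<^sub>C y) t)
           (tensor_map \<delta> id (\<delta> a))) \<and>
    (\<forall>a. twisted_ad_h \<delta> S f (h \<circ> \<iota>) (a\<^sup>\<star> * a) =
         slice_fst (h \<circ> \<iota>) ((twisted_ad \<delta> S f a)\<^sup>\<star> * twisted_ad \<delta> S f a)) \<and>
    preserves_positivity (twisted_ad_h \<delta> S f (h \<circ> \<iota>)) \<and>
    (\<forall>\<omega>. positive_functional \<omega> \<longrightarrow> positive_functional (\<omega> \<circ> twisted_ad_h \<delta> S f (h \<circ> \<iota>))) \<and>
    (kac_type S \<longrightarrow>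
      twisted_ad_h \<delta> S f (h \<circ> \<iota>) \<circ> twisted_ad_h \<delta> S f (h \<circ> \<iota>) = twisted_ad_h \<delta> S f (h \<circ> \<iota>))"
proof -
  interpret pol_algebra \<delta> \<epsilon> S "h \<circ> \<iota>" f
    by (rule pol_algebra_of_compact_quantum_group[OF assms])
  show ?thesis
    using twisted_antipode_eq twisted_ad_h_eq twisted_ad_h_star_mult twisted_ad_h_square
      positive_functional_twisted_ad_h kac_twisted_ad_h_idempotent
    unfolding preserves_positivity_def
    by (simp add: fun_eq_iff)
qed

end
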